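(* The following two statements are equivalent: (i) For every skew partition $\lambda/\mu$, $\mathrm{rank}(\lambda/\mu)=\mathrm{zrank}(\lambda/\mu)$. (ii) Every restricted Cauchy matrix is nonsingular.
   Context: For a skew partition $\lambda/\mu$, $\mathrm{rank}(\lambda/\mu)$ is the smallest number $r$ such that the diagram of $\lambda/\mu$ is a disjoint union of $r$ border strips (a border strip being a connected skew shape with no $2\times 2$ square). Let $s_{\lambda/\mu}(1^t)$ denote the skew Schur function $s_{\lambda/\mu}$ evaluated at $x_1=\cdots=x_t=1$, $x_i=0$ for $i>t$ (a polynomial in $t$); $\mathrm{zrank}(\lambda/\mu)$ is the largest $e$ such that $t^e$ divides $s_{\lambda/\mu}(1^t)$. Restricted Cauchy matrix: let $a=(a_1,\ldots,a_n)$ and $b=(b_1,\ldots,b_n)$ be integer sequences with $a$ strictly decreasing, $b$ strictly increasing, $a_i>b_{n+1-i}$ for all $i$, and $a_i\ne b_j$ for all $i,j$. Define $C(a,b)=(c_{ij})_{i,j=1}^n$ by $c_{ij}=1/(a_i-b_j)$ if $a_i>b_j$ and $c_{ij}=0$ if $a_i<b_j$. A matrix is a restricted Cauchy matrix if it equals $C(a,b)$ for some such $a,b$. A matrix is nonsingular if its determinant is nonzero. *)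

theory Defs
  imports
    "HOL-Library.Disjoint_Sets"
    "HOL-Computational_Algebra.Polynomial"
    "Jordan_Normal_Form.Determinant"
begin

section \<open>Skew partitions and border strips\<close>

text \<open>Partitions are weakly decreasing sequences with finitely many nonzero parts, indexed from 0.\<close>

definition is_partition :: "(nat \<Rightarrow> nat) \<Rightarrow> bool" where
  "is_partition l \<longleftrightarrow> antimono l \<and> finite {i. l i \<noteq> 0}"

definition skew_partition :: "(nat \<Rightarrow> nat) \<Rightarrow> (nat \<Rightarrow> nat) \<Rightarrow> bool" where
  "skew_partition l m \<longleftrightarrow> is_partition l \<and> is_partition m \<and> (\<forall>i. m i \<le> l i)"

text \<open>Cells are pairs (row, column), both counted from 0.\<close>

definition diagram :: "(nat \<Rightarrow> nat) \<Rightarrow> (nat \<Rightarrow> nat) \<Rightarrow> (nat \<times> nat) set" where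
  "diagram l m = {(i, j). m i \<le> j \<and> j < l i}"

definition adjacent :: "nat \<times> nat \<Rightarrow> nat \<times> nat \<Rightarrow> bool" where
  "adjacent c d \<longleftrightarrow>
     (fst c = fst d \<and> (snd d = Suc (snd c) \<or> snd c = Suc (snd d))) \<or>
     (snd c = snd d \<and> (fst d = Suc (fst c) \<or> fst c = Suc (fst d)))"

definition connected_cells :: "(nat \<times> nat) set \<Rightarrow> bool" where
  "connected_cells S \<longleftrightarrow>
     (\<forall>c\<in>S. \<forall>d\<in>S. (c, d) \<in> {(x, y). x \<in> S \<and> y \<in> S \<and> adjacent x y}\<^sup>*)"

definition has_2x2_square :: "(nat \<times> nat) set \<Rightarrow> bool" where
  "has_2x2_square S \<longleftrightarrow>
     (\<exists>i j. {(i, j), (i, Suc j), (Suc i, j), (Suc i, Suc j)} \<subseteq> S)"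

definition border_strip :: "(nat \<times> nat) set \<Rightarrow> bool" where
  "border_strip S \<longleftrightarrow>
     S \<noteq> {} \<and> (\<exists>l m. skew_partition l m \<and> S = diagram l m) \<and>
     connected_cells S \<and> \<not> has_2x2_square S"

definition skew_rank :: "(nat \<Rightarrow> nat) \<Rightarrow> (nat \<Rightarrow> nat) \<Rightarrow> nat" where
  "skew_rank l m =
     (LEAST r. \<exists>P. partition_on (diagram l m) P \<and> (\<forall>S\<in>P. border_strip S) \<and>
                   finite P \<and> card P = r)"

section \<open>Skew Schur functions and zrank\<close>

text \<open>The value 0 outside the diagram makes each tableau a unique function.\<close>

definition ssyt :: "(nat \<Rightarrow> nat) \<Rightarrow> (nat \<Rightarrow> nat) \<Rightarrow> (nat \<times> nat \<Rightarrow> nat) set" where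
  "ssyt l m = {T.
     (\<forall>c. c \<notin> diagram l m \<longrightarrow> T c = 0) \<and>
     (\<forall>c\<in>diagram l m. 1 \<le> T c) \<and>
     (\<forall>i j. (i, j) \<in> diagram l m \<and> (i, Suc j) \<in> diagram l m \<longrightarrow> T (i, j) \<le> T (i, Suc j)) \<and>
     (\<forall>i j. (i, j) \<in> diagram l m \<and> (Suc i, j) \<in> diagram l m \<longrightarrow> T (i, j) < T (Suc i, j))}"

definition tableau_weight ::
  "(nat \<Rightarrow> nat) \<Rightarrow> (nat \<Rightarrow> nat) \<Rightarrow> (nat \<Rightarrow> rat) \<Rightarrow> (nat \<times> nat \<Rightarrow> nat) \<Rightarrow> rat" where
  "tableau_weight l m x T = (\<Prod>c\<in>diagram l m. x (T c))"

text \<open>The value of the skew Schur function at \<open>x\<^sub>1, x\<^sub>2, \<dots>\<close> (\<open>x 0\<close> is irrelevant), meaningful when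
  only finitely many \<open>x\<^sub>i\<close> are nonzero: then only finitely many tableaux have nonzero weight,
  and the sum ranges over exactly those.\<close>

definition skew_schur :: "(nat \<Rightarrow> nat) \<Rightarrow> (nat \<Rightarrow> nat) \<Rightarrow> (nat \<Rightarrow> rat) \<Rightarrow> rat" where
  "skew_schur l m x =
     (\<Sum>T | T \<in> ssyt l m \<and> tableau_weight l m x T \<noteq> 0. tableau_weight l m x T)"

definition principal :: "nat \<Rightarrow> nat \<Rightarrow> rat" where
  "principal t i = (if 1 \<le> i \<and> i \<le> t then 1 else 0)"

text \<open>The polynomial \<open>s(1\<^sup>t)\<close> in \<open>t\<close>; existence and uniqueness are shown in
  \<open>schur_poly_ex1\<close> below.\<close>

definition schur_poly :: "(nat \<Rightarrow> nat) \<Rightarrow> (nat \<Rightarrow> nat) \<Rightarrow> rat poly" where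
  "schur_poly l m = (THE p. \<forall>t. poly p (of_nat t) = skew_schur l m (principal t))"

definition zrank :: "(nat \<Rightarrow> nat) \<Rightarrow> (nat \<Rightarrow> nat) \<Rightarrow> nat" where
  "zrank l m = (GREATEST e. [:0, 1:] ^ e dvd schur_poly l m)"

section \<open>Restricted Cauchy matrices\<close>

definition cauchy_mat :: "nat \<Rightarrow> (nat \<Rightarrow> int) \<Rightarrow> (nat \<Rightarrow> int) \<Rightarrow> rat mat" where
  "cauchy_mat n a b =
     mat n n (\<lambda>(i, j). if a i > b j then 1 / of_int (a i - b j) else 0)"

text \<open>Indices run over \<open>0, \<dots>, n - 1\<close>, so the index \<open>n + 1 - i\<close> of the 1-based convention becomes
  \<open>n - 1 - i\<close>.\<close>

definition restricted_cauchy :: "rat mat \<Rightarrow> bool" where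
  "restricted_cauchy A \<longleftrightarrow>
     (\<exists>n a b.
        (\<forall>i<n. \<forall>j<n. i < j \<longrightarrow> a j < a i) \<and>
        (\<forall>i<n. \<forall>j<n. i < j \<longrightarrow> b i < b j) \<and>
        (\<forall>i<n. a i > b (n - 1 - i)) \<and>
        (\<forall>i<n. \<forall>j<n. a i \<noteq> b j) \<and>
        A = cauchy_mat n a b)"

definition nonsingular :: "rat mat \<Rightarrow> bool" where
  "nonsingular A \<longleftrightarrow> det A \<noteq> 0"

section \<open>Well-definedness of the polynomial\<close>

lemma finite_diagram:
  assumes "skew_partition l m"
  shows "finite (diagram l m)"
proof -
  have "finite {i. l i \<noteq> 0}"
    using assms by (simp add: skew_partition_def is_partition_def)
  then have "finite (Sigma {i. l i \<noteq> 0} (\<lambda>i. {..<l i}))"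
    by simp
  then show ?thesis
    by (rule finite_subset[rotated]) (auto simp: diagram_def)
qed

definition ssyt_image :: "(nat \<Rightarrow> nat) \<Rightarrow> (nat \<Rightarrow> nat) \<Rightarrow> nat set \<Rightarrow> (nat \<times> nat \<Rightarrow> nat) set" where
  "ssyt_image l m A = {T \<in> ssyt l m. T ` diagram l m = A}"

lemma finite_ssyt_bounded:
  assumes "finite (diagram l m)"
  shows "finite {T \<in> ssyt l m. T ` diagram l m \<subseteq> {1..t}}"
proof -
  have "finite {T. (\<forall>c. (c \<in> diagram l m \<longrightarrow> T c \<in> {1..t}) \<and> (c \<notin> diagram l m \<longrightarrow> T c = (0::nat)))}"
    using assms by (intro finite_set_of_finite_funs) auto
  then show ?thesis
    by (rule finite_subset[rotated]) (auto simp: ssyt_def)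
qed

lemma skew_schur_principal:
  assumes "finite (diagram l m)"
  shows "skew_schur l m (principal t) = of_nat (card {T \<in> ssyt l m. T ` diagram l m \<subseteq> {1..t}})"
proof -
  have w: "tableau_weight l m (principal t) T = (if T ` diagram l m \<subseteq> {1..t} then 1 else 0)" for T
  proof (cases "T ` diagram l m \<subseteq> {1..t}")
    case True
    then have "\<forall>c\<in>diagram l m. principal t (T c) = 1"
      by (auto simp: principal_def)
    with True show ?thesis by (simp add: tableau_weight_def)
  next
    case False
    then obtain c where c: "c \<in> diagram l m" "T c \<notin> {1..t}" by blast
    then have "principal t (T c) = 0" by (auto simp: principal_def)
    with c(1) have "(\<Prod>c\<in>diagram l m. principal t (T c)) = 0"
      using assms by (intro prod_zero) auto
    with False show ?thesis by (simp only: tableau_weight_def if_False)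
  qed
  have eq: "{T. T \<in> ssyt l m \<and> tableau_weight l m (principal t) T \<noteq> 0}
      = {T \<in> ssyt l m. T ` diagram l m \<subseteq> {1..t}}"
    by (auto simp: w)
  show ?thesis
    unfolding skew_schur_def eq by (simp add: w)
qed

lemma card_ssyt_image_le:
  assumes A: "A \<subseteq> {1..}" and B: "B \<subseteq> {1..}" "finite B"
    and f: "bij_betw f A B" "strict_mono_on A f"
    and fin: "finite (ssyt_image l m B)"
  shows "card (ssyt_image l m A) \<le> card (ssyt_image l m B)"
proof (rule card_inj_on_le[where f = "\<lambda>T c. if c \<in> diagram l m then f (T c) else 0"])
  let ?g = "\<lambda>T c. if c \<in> diagram l m then f (T c) else (0::nat)"
  have inj: "inj_on f A" using f(1) by (simp add: bij_betw_def)
  show "inj_on ?g (ssyt_image l m A)"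
  proof (rule inj_onI, rule ext)
    fix T U c assume T: "T \<in> ssyt_image l m A" and U: "U \<in> ssyt_image l m A" and e: "?g T = ?g U"
    show "T c = U c"
    proof (cases "c \<in> diagram l m")
      case True
      then have "f (T c) = f (U c)" using fun_cong[OF e, of c] by simp
      moreover have "T c \<in> A" "U c \<in> A" using T U True by (auto simp: ssyt_image_def)
      ultimately show ?thesis using inj by (auto dest: inj_onD)
    next
      case False then show ?thesis using T U by (cases c) (simp add: ssyt_image_def ssyt_def)
    qed
  qed
  show "?g ` ssyt_image l m A \<subseteq> ssyt_image l m B"
  proof clarify
    fix T assume T: "T \<in> ssyt_image l m A"
    have mem: "T c \<in> A" if "c \<in> diagram l m" for c
      using T that by (auto simp: ssyt_image_def)
    have lt: "f x < f y" if "x \<in> A" "y \<in> A" "x < y" for x y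
      using f(2) that by (auto simp: strict_mono_on_def)
    have le: "f x \<le> f y" if "x \<in> A" "y \<in> A" "x \<le> y" for x y
      using lt[of x y] that by (cases "x = y") auto
    have im: "f ` A = B" using f(1) by (simp add: bij_betw_def)
    have "?g T ` diagram l m = f ` (T ` diagram l m)" by (auto simp: image_image)
    also have "\<dots> = B" using T im by (simp add: ssyt_image_def)
    finally have 1: "?g T ` diagram l m = B" .
    have pos: "1 \<le> f (T c)" if "c \<in> diagram l m" for c
      using mem[OF that] im B(1) by (metis atLeast_iff imageI subsetD)
    have "?g T \<in> ssyt l m"
      using T mem lt le pos unfolding ssyt_image_def ssyt_def by simp
    with 1 show "?g T \<in> ssyt_image l m B" by (simp add: ssyt_image_def)
  qed
qed (rule fin)

lemma finite_ssyt_image: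
  assumes "finite (diagram l m)" and "finite A"
  shows "finite (ssyt_image l m A)"
proof -
  obtain t where t: "\<forall>x\<in>A. x \<le> t" using assms(2) finite_nat_set_iff_bounded_le by blast
  have "ssyt_image l m A \<subseteq> {T \<in> ssyt l m. T ` diagram l m \<subseteq> {1..t}}"
    using t by (auto simp: ssyt_image_def ssyt_def)
  then show ?thesis using finite_ssyt_bounded[OF assms(1)] by (rule finite_subset)
qed

lemma card_ssyt_image:
  assumes fin: "finite (diagram l m)" and A: "finite A" "A \<subseteq> {1..}"
  shows "card (ssyt_image l m A) = card (ssyt_image l m {1..card A})"
proof -
  let ?xs = "sorted_list_of_set A"
  let ?f = "\<lambda>i. ?xs ! (i - 1)"
  have sm: "strict_mono_on {1..card A} ?f"
    using strict_sorted_list_of_set[of A]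
    by (intro strict_mono_onI) (auto simp: sorted_wrt_iff_nth_less)
  have im: "?f ` {1..card A} = A"
  proof -
    have "?f ` {1..card A} = (\<lambda>i. ?xs ! i) ` {..<length ?xs}"
      by (force simp: image_iff Bex_def intro: exI[of _ "Suc _"])
    also have "\<dots> = A" using A(1) by (metis atLeast_upt list.set_map map_nth set_sorted_list_of_set)
    finally show ?thesis .
  qed
  have bij: "bij_betw ?f {1..card A} A"
    using sm im by (simp add: bij_betw_def strict_mono_on_imp_inj_on)
  let ?g = "the_inv_into {1..card A} ?f"
  have bij': "bij_betw ?g A {1..card A}" using bij by (rule bij_betw_the_inv_into)
  have sm': "strict_mono_on A ?g"
  proof (rule strict_mono_onI)
    fix x y assume xy: "x \<in> A" "y \<in> A" "x < y"
    have inj: "inj_on ?f {1..card A}" using bij by (simp add: bij_betw_def)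
    have "?f (?g x) = x" "?f (?g y) = y"
      using xy im f_the_inv_into_f[OF inj] by auto
    moreover have "?g x \<in> {1..card A}" "?g y \<in> {1..card A}"
      using bij' xy by (auto simp: bij_betw_def)
    ultimately show "?g x < ?g y"
      using xy(3) strict_mono_onD[OF sm, of "?g y" "?g x"] by (metis linorder_neqE_nat order.asym)
  qed
  show ?thesis
    by (intro antisym card_ssyt_image_le[OF _ _ _ bij' sm'] card_ssyt_image_le[OF _ _ _ bij sm]
        finite_ssyt_image fin) (use A in auto)
qed

lemma skew_schur_principal_binomial:
  assumes fin: "finite (diagram l m)"
  shows "skew_schur l m (principal t) =
    (\<Sum>k\<le>card (diagram l m). of_nat (t choose k) * of_nat (card (ssyt_image l m {1..k})))"
proof -
  let ?D = "diagram l m"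
  let ?c = "\<lambda>k. card (ssyt_image l m {1..k})"
  have "{T \<in> ssyt l m. T ` ?D \<subseteq> {1..t}} = (\<Union>A\<in>Pow {1..t}. ssyt_image l m A)"
    unfolding ssyt_image_def by blast
  also have "card \<dots> = (\<Sum>A\<in>Pow {1..t}. card (ssyt_image l m A))"
  proof (rule card_UN_disjoint)
    show "\<forall>A\<in>Pow {1..t}. finite (ssyt_image l m A)"
      by (auto intro!: finite_ssyt_image fin intro: finite_subset)
  qed (auto simp: ssyt_image_def)
  also have "\<dots> = (\<Sum>A\<in>Pow {1..t}. ?c (card A))"
    by (intro sum.cong refl card_ssyt_image fin) (auto intro: finite_subset)
  also have "\<dots> = (\<Sum>k\<le>t. \<Sum>A | A \<in> Pow {1..t} \<and> card A = k. ?c (card A))"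
    by (rule sum.group[symmetric]) (auto dest: card_mono[rotated])
  also have "\<dots> = (\<Sum>k\<le>t. (t choose k) * ?c k)"
    by (intro sum.cong refl) (simp add: n_subsets)
  also have "\<dots> = (\<Sum>k\<le>t + card ?D. (t choose k) * ?c k)"
    by (rule sum.mono_neutral_left) auto
  also have "\<dots> = (\<Sum>k\<le>card ?D. (t choose k) * ?c k)"
  proof (rule sum.mono_neutral_right)
    show "\<forall>k\<in>{..t + card ?D} - {..card ?D}. (t choose k) * ?c k = 0"
    proof
      fix k assume k: "k \<in> {..t + card ?D} - {..card ?D}"
      have "card (T ` ?D) < k" for T :: "nat \<times> nat \<Rightarrow> nat"
        using card_image_le[OF fin, of T] k by simp
      then have "T ` ?D \<noteq> {1..k}" for T :: "nat \<times> nat \<Rightarrow> nat"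
        by (metis card_atLeastAtMost diff_Suc_1 less_irrefl One_nat_def)
      then have "ssyt_image l m {1..k} = {}"
        unfolding ssyt_image_def by blast
      then show "(t choose k) * ?c k = 0" by simp
    qed
  qed auto
  finally show ?thesis
    by (simp add: skew_schur_principal[OF fin])
qed

lemma schur_poly_ex1:
  assumes "skew_partition l m"
  shows "\<exists>!p. \<forall>t. poly p (of_nat t) = skew_schur l m (principal t)"
proof -
  note fin = finite_diagram[OF assms]
  define p :: "rat poly" where
    "p = (\<Sum>k\<le>card (diagram l m).
       smult (of_nat (card (ssyt_image l m {1..k})) / fact k) (\<Prod>i<k. [:- of_nat i, 1:]))"
  have p: "\<forall>t. poly p (of_nat t) = skew_schur l m (principal t)"
    unfolding p_def skew_schur_principal_binomial[OF fin]
    by (auto simp: poly_sum poly_prod binomial_gbinomial gbinomial_prod_rev atLeast0LessThan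
        intro!: sum.cong)
  have uniq: "q = p" if q: "\<forall>t. poly q (of_nat t) = skew_schur l m (principal t)" for q
  proof (rule ccontr)
    assume "q \<noteq> p"
    then have "finite {x. poly (q - p) x = 0}" by (intro poly_roots_finite) simp
    moreover have "range (of_nat :: nat \<Rightarrow> rat) \<subseteq> {x. poly (q - p) x = 0}"
      using p q by auto
    moreover have "infinite (range (of_nat :: nat \<Rightarrow> rat))"
      by (intro range_inj_infinite injI) simp
    ultimately show False using finite_subset by blast
  qed
  show ?thesis using p uniq by blast
qed

end

theory Submission
  imports Defs
begin

text \<open>Put \<open>A = {l\<^sub>i - i}\<close> and \<open>B = {m\<^sub>i - i}\<close>. Passing from content \<open>c - 1\<close> to \<open>c\<close>, the number of cells
  of the skew diagram on the diagonal changes by \<open>[c \<in> B] - [c \<in> A]\<close>. Every \<open>c \<in> A - B\<close> therefore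
  forces a strip that ends at content \<open>c - 1\<close>, and peeling the rim realises exactly these strips: the
  rank is \<open>|A - B|\<close>. On the other side, \<open>s(1\<^sup>t)\<close> is the Jacobi--Trudi determinant with entries
  \<open>h\<^sub>k(1\<^sup>t)\<close> for \<open>k = x - y\<close>, \<open>x \<in> A\<close>, \<open>y \<in> B\<close>, where \<open>h\<^sub>0 = 1\<close>, \<open>h\<^sub>k = t/k + O(t\<^sup>2)\<close> for \<open>k > 0\<close> and
  \<open>h\<^sub>k = 0\<close> for \<open>k < 0\<close>. Only the rows \<open>x \<in> A - B\<close> lack an entry 1, so \<open>t\<close> to the power \<open>|A - B|\<close>
  divides the determinant, and the coefficient there is, up to sign, the determinant of the
  Cauchy matrix with rows \<open>A - B\<close> and columns \<open>B - A\<close>. These are exactly the restricted Cauchy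
  matrices.\<close>

section \<open>Beta numbers and diagonals\<close>

text \<open>Subtracting the row index turns the weakly decreasing parts into a strictly decreasing
  sequence, so a partition becomes a set of integers. The value is also the content of the first
  cell to the right of row \<open>i\<close>.\<close>

definition beta_num :: "(nat \<Rightarrow> nat) \<Rightarrow> nat \<Rightarrow> int" where
  "beta_num l i = int (l i) - int i"

text \<open>This is the row at which the diagonal of content \<open>c\<close> leaves the shape
  \<open>l\<close>. For negative \<open>c\<close> it also counts rows that lie above the start of
  the diagonal; these cancel in the difference between \<open>l\<close> and
  \<open>m\<close>.\<close>

definition rows_above :: "(nat \<Rightarrow> nat) \<Rightarrow> int \<Rightarrow> nat" where
  "rows_above l c = card {i. c < beta_num l i}"

lemma beta_num_less:
  assumes "antimono l" "i < j"
  shows "beta_num l j < beta_num l i"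
  using antimonoD[OF assms(1), of i j] assms(2) by (simp add: beta_num_def)

lemma beta_num_le:
  assumes "antimono l" "i \<le> j"
  shows "beta_num l j \<le> beta_num l i"
  using beta_num_less[OF assms(1), of i j] assms(2) by (cases "i = j") auto

lemma inj_beta_num:
  assumes "antimono l"
  shows "inj (beta_num l)"
  by (intro linorder_injI) (metis assms beta_num_less less_irrefl)

lemma finite_beta_num_greater:
  assumes "antimono l"
  shows "finite {i. c < beta_num l i}"
proof (rule finite_subset)
  show "{i. c < beta_num l i} \<subseteq> {..nat (int (l 0) - c)}"
  proof
    fix i assume "i \<in> {i. c < beta_num l i}"
    then show "i \<in> {..nat (int (l 0) - c)}"
      using antimonoD[OF assms, of 0 i] by (auto simp: beta_num_def)
  qed
qed simp

text \<open>Beta numbers decrease, so the rows whose beta number exceeds \<open>c\<close> form an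
  initial segment, which its cardinality determines.\<close>

lemma less_rows_above_iff:
  assumes "antimono l"
  shows "i < rows_above l c \<longleftrightarrow> c < beta_num l i"
proof
  assume *: "c < beta_num l i"
  then have "{..i} \<subseteq> {i. c < beta_num l i}"
    using beta_num_le[OF assms] by (force intro: less_le_trans)
  then have "card {..i} \<le> rows_above l c"
    unfolding rows_above_def by (intro card_mono finite_beta_num_greater assms)
  then show "i < rows_above l c" by simp
next
  assume *: "i < rows_above l c"
  show "c < beta_num l i"
  proof (rule ccontr)
    assume "\<not> c < beta_num l i"
    then have "{j. c < beta_num l j} \<subseteq> {..<i}"
      using beta_num_le[OF assms, of i] by (auto simp: not_less) (meson le_less_trans not_less)
    then have "rows_above l c \<le> card {..<i}"
      unfolding rows_above_def by (intro card_mono) auto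
    with * show False by simp
  qed
qed

text \<open>Lowering the threshold by one adds the rows with beta number exactly \<open>c\<close>;
  by injectivity there is at most one.\<close>

lemma rows_above_step:
  assumes "antimono l"
  shows "rows_above l (c - 1) = rows_above l c + (if c \<in> range (beta_num l) then 1 else 0)"
proof -
  have le: "{j. c - 1 < beta_num l j} = {j. beta_num l j = c} \<union> {j. c < beta_num l j}"
    by auto
  show ?thesis
  proof (cases "c \<in> range (beta_num l)")
    case True
    then obtain i where i: "beta_num l i = c" by auto
    then have "{j. beta_num l j = c} = {i}"
      using inj_eq[OF inj_beta_num[OF assms]] by auto
    then show ?thesis
      using True i finite_beta_num_greater[OF assms, of c] unfolding rows_above_def le by simp
  next
    case False
    then have "{j. beta_num l j = c} = {}" by auto
    then show ?thesis using False unfolding rows_above_def le by simp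
  qed
qed

lemma rows_above_mono:
  assumes "antimono m" "antimono l" "\<And>i. m i \<le> l i"
  shows "rows_above m c \<le> rows_above l c"
proof (rule ccontr)
  assume "\<not> ?thesis"
  then have "rows_above l c < rows_above m c" by simp
  then have "c < beta_num m (rows_above l c)"
    using less_rows_above_iff[OF assms(1)] by simp
  then have "c < beta_num l (rows_above l c)"
    using assms(3)[of "rows_above l c"] by (simp add: beta_num_def)
  then show False using less_rows_above_iff[OF assms(2)] by blast
qed

text \<open>The condition \<open>y < l x\<close> says that the content \<open>y - x\<close> is below
  \<open>beta_num l x\<close>. Hence each diagonal of the skew diagram is an interval of
  rows.\<close>

lemma diagram_iff_rows_above:
  assumes "antimono l" "antimono m"
  shows "(x, y) \<in> diagram l m \<longleftrightarrow>
    rows_above m (int y - int x) \<le> x \<and> x < rows_above l (int y - int x)"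
  using less_rows_above_iff[OF assms(1), of x "int y - int x"]
    less_rows_above_iff[OF assms(2), of x "int y - int x"]
  by (auto simp: diagram_def beta_num_def)

section \<open>Border strips\<close>

text \<open>This criterion supplies the skew shape demanded by \<open>border_strip\<close>. Take for
  \<open>l\<close> the furthest column end found in row \<open>i\<close> or below, and for
  \<open>m\<close> the first column found in row \<open>i\<close> or above. A cell between the two
  has cells of \<open>S\<close> weakly north-west and weakly south-east of it, so convexity puts it
  into \<open>S\<close>.\<close>

lemma convex_cells_skew_diagram:
  assumes fin: "finite S"
    and conv: "\<And>i j i' j' x y. (i, j) \<in> S \<Longrightarrow> (i', j') \<in> S \<Longrightarrow> i \<le> x \<Longrightarrow> x \<le> i' \<Longrightarrow>
      j \<le> y \<Longrightarrow> y \<le> j' \<Longrightarrow> (x, y) \<in> S"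
  shows "\<exists>l m. skew_partition l m \<and> S = diagram l m"
proof (intro exI conjI)
  define L where "L i = insert 0 {Suc j |j i'. i \<le> i' \<and> (i', j) \<in> S}" for i
  define l where "l i = Max (L i)" for i
  \<comment> \<open>The default \<open>l i\<close> makes row \<open>i\<close> empty when
    \<open>S\<close> has no cell in row \<open>i\<close> or above, and it caps \<open>m i\<close> by
    \<open>l i\<close>.\<close>
  define M where "M i = insert (l i) {j |j i'. i' \<le> i \<and> (i', j) \<in> S}" for i
  define m where "m i = Min (M i)" for i
  have "L i \<subseteq> insert 0 ((Suc \<circ> snd) ` S)" for i
    by (force simp: L_def image_iff)
  then have finL: "finite (L i)" for i
    by (rule finite_subset) (use fin in simp)
  have "M i \<subseteq> insert (l i) (snd ` S)" for i
    by (force simp: M_def image_iff)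
  then have finM: "finite (M i)" for i
    by (rule finite_subset) (use fin in simp)
  have l_anti: "antimono l"
    unfolding l_def by (intro antimonoI Max_mono finL) (auto simp: L_def intro: order_trans)
  have m_anti: "antimono m"
  proof (rule antimonoI)
    fix i k :: nat assume ik: "i \<le> k"
    have "Min (M k) \<le> x" if x: "x \<in> M i" for x
    proof -
      from x ik consider "x = l i" | "x \<in> M k"
        unfolding M_def by (blast intro: order_trans)
      then show ?thesis
      proof cases
        case 1
        have "Min (M k) \<le> l k" by (rule Min_le[OF finM]) (simp add: M_def)
        also have "\<dots> \<le> x" using 1 antimonoD[OF l_anti ik] by simp
        finally show ?thesis .
      qed (rule Min_le[OF finM])
    qed
    then show "m k \<le> m i"
      unfolding m_def using finM by (subst Min_ge_iff) (auto simp: M_def)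
  qed
  have ml: "m i \<le> l i" for i
    unfolding m_def by (rule Min_le[OF finM]) (simp add: M_def)
  have "{i. l i \<noteq> 0} \<subseteq> (\<Union>(i, j)\<in>S. {..i})"
  proof
    fix i assume i: "i \<in> {i. l i \<noteq> 0}"
    have "l i \<in> L i" unfolding l_def by (rule Max_in[OF finL]) (simp add: L_def)
    with i show "i \<in> (\<Union>(i, j)\<in>S. {..i})" by (auto simp: L_def)
  qed
  then have lfin: "finite {i. l i \<noteq> 0}"
    by (rule finite_subset) (use fin in auto)
  have mfin: "finite {i. m i \<noteq> 0}"
  proof (rule finite_subset[OF _ lfin])
    show "{i. m i \<noteq> 0} \<subseteq> {i. l i \<noteq> 0}" using ml by (metis (mono_tags) le_zero_eq mem_Collect_eq subsetI)
  qed
  show "skew_partition l m"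
    using l_anti m_anti ml lfin mfin by (simp add: skew_partition_def is_partition_def)
  show "S = diagram l m"
  proof (intro equalityI subsetI)
    fix c assume c: "c \<in> S"
    obtain i j where [simp]: "c = (i, j)" by (cases c)
    have "Suc j \<le> l i" unfolding l_def by (rule Max_ge[OF finL]) (use c in \<open>auto simp: L_def\<close>)
    moreover have "m i \<le> j" unfolding m_def by (rule Min_le[OF finM]) (use c in \<open>auto simp: M_def\<close>)
    ultimately show "c \<in> diagram l m" by (simp add: diagram_def)
  next
    fix c assume c: "c \<in> diagram l m"
    obtain i j where [simp]: "c = (i, j)" by (cases c)
    from c have ij: "m i \<le> j" "j < l i" by (auto simp: diagram_def)
    have "l i \<in> L i" unfolding l_def by (rule Max_in[OF finL]) (simp add: L_def)
    with ij obtain i1 j1 where 1: "i \<le> i1" "(i1, j1) \<in> S" "j \<le> j1" by (auto simp: L_def)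
    have "m i \<in> M i" unfolding m_def by (rule Min_in[OF finM]) (simp add: M_def)
    with ij obtain i2 j2 where 2: "i2 \<le> i" "(i2, j2) \<in> S" "j2 \<le> j" by (auto simp: M_def)
    show "c \<in> S" using conv[OF 2(2) 1(2) 2(1) 1(1) 2(3) 1(3)] by simp
  qed
qed

text \<open>A strip is given by its set \<open>I\<close> of contents and the row \<open>r c\<close> of its cell of content \<open>c\<close>.\<close>

lemma border_strip_of_contents:
  fixes r :: "int \<Rightarrow> nat" and I :: "int set"
  defines "f \<equiv> \<lambda>c. (r c, nat (int (r c) + c))"
  assumes fin: "finite I" and ne: "I \<noteq> {}"
    and int: "\<And>x y z. x \<in> I \<Longrightarrow> z \<in> I \<Longrightarrow> x \<le> y \<Longrightarrow> y \<le> z \<Longrightarrow> y \<in> I"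
    and pos: "\<And>c. c \<in> I \<Longrightarrow> 0 \<le> int (r c) + c"
    and row_step: "\<And>c. c \<in> I \<Longrightarrow> c + 1 \<in> I \<Longrightarrow> r c = r (c + 1) \<or> r c = Suc (r (c + 1))"
  shows "border_strip (f ` I)"
proof -
  \<comment> \<open>Each step to the next content goes right or up, so rows weakly decrease and
    columns \<open>r c + c\<close> weakly increase along the strip.\<close>
  have mono: "r c' \<le> r c \<and> int (r c) + c \<le> int (r c') + c'"
    if "c \<in> I" "c' \<in> I" "c \<le> c'" for c c'
    using that(3,2)
  proof (induction c' rule: int_ge_induct)
    case (step k)
    have k: "k \<in> I" using int[OF that(1) step.prems, of k] step.hyps by simp
    show ?case using step.IH[OF k] row_step[OF k step.prems] by auto
  qed simp
  have mem: "(x, y) \<in> f ` I \<longleftrightarrow> int y - int x \<in> I \<and> r (int y - int x) = x" for x y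
  proof
    assume "(x, y) \<in> f ` I"
    then obtain c where c: "c \<in> I" "r c = x" "nat (int (r c) + c) = y" by (auto simp: f_def)
    then have "int y - int x = c" using pos[OF c(1)] by auto
    then show "int y - int x \<in> I \<and> r (int y - int x) = x" using c by simp
  next
    assume "int y - int x \<in> I \<and> r (int y - int x) = x"
    then show "(x, y) \<in> f ` I" by (auto simp: f_def intro!: image_eqI[of _ _ "int y - int x"])
  qed
  have "\<exists>l m. skew_partition l m \<and> f ` I = diagram l m"
  proof (rule convex_cells_skew_diagram)
    fix i j i' j' x y
    assume c: "(i, j) \<in> f ` I" and c': "(i', j') \<in> f ` I"
      and le: "i \<le> x" "x \<le> i'" "j \<le> y" "y \<le> j'"
    define u where "u = int j - int i"
    define v where "v = int j' - int i'"
    have u: "u \<in> I" "r u = i" "int (r u) + u = j"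
      and v: "v \<in> I" "r v = i'" "int (r v) + v = j'"
      using c c' by (auto simp: mem u_def v_def)
    \<comment> \<open>Two cells of the strip in north-west to south-east order must, by
      monotonicity, share a row or a column. The box they span is then a segment, whose cells the
      strip traverses.\<close>
    show "(x, y) \<in> f ` I"
    proof (cases "u \<le> v")
      case True
      then have "int (r v) \<le> int (r u)" using mono[OF u(1) v(1)] by simp
      then have eq: "i' = i" "x = i" using u v le by auto
      have w: "int y - int x \<in> I" using int[OF u(1) v(1)] le u v eq by simp
      have "r v \<le> r (int y - int x)" "r (int y - int x) \<le> r u"
        using mono[OF u(1) w] mono[OF w v(1)] le u v eq by auto
      then show ?thesis using u v eq w unfolding mem by simp
    next
      case False
      then have "int (r v) + v \<le> int (r u) + u" using mono[OF v(1) u(1)] by simp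
      then have eq: "j' = j" "y = j" using u v le by auto
      have w: "int y - int x \<in> I" using int[OF v(1) u(1)] le u v eq by simp
      have "int (r v) + v \<le> int (r (int y - int x)) + (int y - int x)"
        "int (r (int y - int x)) + (int y - int x) \<le> int (r u) + u"
        using mono[OF v(1) w] mono[OF w u(1)] le u v eq by auto
      then have "r (int y - int x) = x" using u v eq by linarith
      then show ?thesis using w unfolding mem by simp
    qed
  qed (simp add: fin)
  moreover have "connected_cells (f ` I)"
  proof -
    let ?R = "{(x, y). x \<in> f ` I \<and> y \<in> f ` I \<and> adjacent x y}"
    have up: "(f c, f c') \<in> ?R\<^sup>*" if "c \<in> I" "c' \<in> I" "c \<le> c'" for c c'
      using that(3,2)
    proof (induction c' rule: int_ge_induct)
      case (step k)
      have k: "k \<in> I" using int[OF that(1) step.prems, of k] step.hyps by simp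
      have "adjacent (f k) (f (k + 1))"
        using row_step[OF k step.prems] pos[OF k] pos[OF step.prems]
        by (auto simp: f_def adjacent_def)
      then have "(f k, f (k + 1)) \<in> ?R" using k step.prems by blast
      with step.IH[OF k] show ?case by (rule rtrancl_into_rtrancl)
    qed simp
    have "sym ?R" by (auto simp: sym_def adjacent_def)
    then have "sym (?R\<^sup>*)" by (rule sym_rtrancl)
    then have "(f c, f c') \<in> ?R\<^sup>*" if "c \<in> I" "c' \<in> I" for c c'
      using up[OF that] up[OF that(2,1)] by (cases "c \<le> c'") (auto dest: symD)
    then show ?thesis unfolding connected_cells_def by blast
  qed
  \<comment> \<open>A square contains two cells of equal content, while \<open>r\<close> assigns
    only one row to each content.\<close>
  moreover have "\<not> has_2x2_square (f ` I)"
    unfolding has_2x2_square_def by (auto simp: mem)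
  ultimately show ?thesis using ne by (simp add: border_strip_def)
qed

text \<open>If a skew shape has two cells on one diagonal, then it also contains the square whose
  north-west corner is the upper of them.\<close>

lemma border_strip_diagonal_unique:
  assumes S: "border_strip S" and "(i, j) \<in> S" "(i', j') \<in> S"
    and eq: "int j - int i = int j' - int i'"
  shows "(i, j) = (i', j')"
proof -
  obtain l m where lm: "skew_partition l m" "S = diagram l m" "\<not> has_2x2_square S"
    using S by (auto simp: border_strip_def)
  then have anti: "antimono l" "antimono m" by (auto simp: skew_partition_def is_partition_def)
  have *: False if "(i, j) \<in> S" "(i', j') \<in> S" "int j - int i = int j' - int i'" "i < i'"
    for i j i' j'
  proof -
    have "l i' \<le> l (Suc i)" "l (Suc i) \<le> l i" "m (Suc i) \<le> m i"
      using anti that(4) by (auto intro: antimonoD)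
    then have "{(i, j), (i, Suc j), (Suc i, j), (Suc i, Suc j)} \<subseteq> S"
      using that unfolding lm(2) diagram_def by auto
    then show False using lm(3) unfolding has_2x2_square_def by blast
  qed
  have "\<not> i < i'" "\<not> i' < i" using *[of i j i' j'] *[of i' j' i j] assms by auto
  with eq show ?thesis by auto
qed

text \<open>Contents of adjacent cells differ by one, so a path of cells cannot skip a
  content.\<close>

lemma border_strip_contents_interval:
  assumes S: "border_strip S" and c: "(i, j) \<in> S" and d: "(i', j') \<in> S"
    and x: "int j - int i \<le> x" "x \<le> int j' - int i'"
  shows "\<exists>(p, q)\<in>S. int q - int p = x"
proof -
  have "((i, j), (i', j')) \<in> {(x, y). x \<in> S \<and> y \<in> S \<and> adjacent x y}\<^sup>*"
    using S c d unfolding border_strip_def connected_cells_def by blast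
  then have "x \<le> int (snd (i', j')) - int (fst (i', j')) \<Longrightarrow> \<exists>(p, q)\<in>S. int q - int p = x"
  proof (induction rule: rtrancl_induct)
    case base
    then show ?case using x c by force
  next
    case (step y z)
    show ?case
    proof (cases "x \<le> int (snd y) - int (fst y)")
      case False
      then have "x = int (snd z) - int (fst z)"
        using step by (auto simp: adjacent_def)
      then show ?thesis using step by (auto intro!: bexI[of _ z])
    qed (rule step.IH)
  qed
  then show ?thesis using x by simp
qed

section \<open>The rank from the lengths of the diagonals\<close>

lemma skew_rank_eqI:
  assumes "\<exists>P. partition_on (diagram l m) P \<and> (\<forall>S\<in>P. border_strip S) \<and> finite P \<and> card P \<le> r"
    and "\<And>P. partition_on (diagram l m) P \<Longrightarrow> (\<forall>S\<in>P. border_strip S) \<Longrightarrow> finite P \<Longrightarrow> r \<le> card P"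
  shows "skew_rank l m = r"
  unfolding skew_rank_def
proof (rule Least_equality)
  show "\<exists>P. partition_on (diagram l m) P \<and> (\<forall>S\<in>P. border_strip S) \<and> finite P \<and> card P = r"
    using assms by (meson antisym)
qed (use assms(2) in blast)

lemma skew_rank_eq_card:
  assumes sk: "skew_partition l m"
  shows "skew_rank l m = card (range (beta_num l) - range (beta_num m))"
proof -
  have anti: "antimono l" "antimono m" and ml: "\<And>i. m i \<le> l i"
    using sk by (auto simp: skew_partition_def is_partition_def)
  note fin = finite_diagram[OF sk]
  note dia = diagram_iff_rows_above[OF anti]
  define X where "X = range (beta_num l) - range (beta_num m)"
  define d where "d c = rows_above l c - rows_above m c" for c
  have le: "rows_above m c \<le> rows_above l c" for c
    using rows_above_mono[OF anti(2,1) ml] .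
  have d_le: "d c \<le> rows_above l c" for c by (simp add: d_def)
  \<comment> \<open>This is the difference of \<open>rows_above_step\<close> for \<open>l\<close>
    and for \<open>m\<close>, arranged with additions only because \<open>d\<close> takes natural
    values.\<close>
  have d_step: "d (c - 1) + (if c \<in> range (beta_num m) then 1 else 0)
      = d c + (if c \<in> range (beta_num l) then 1 else 0)" for c
    using rows_above_step[OF anti(1), of c] rows_above_step[OF anti(2), of c]
      le[of c] le[of "c - 1"] by (simp add: d_def)
  \<comment> \<open>Such a row has \<open>beta_num m x <= c\<close>, and a beta number is at least
    \<open>- x\<close>; so the column \<open>x + c\<close> is not negative.\<close>
  have pos: "0 \<le> int x + c" if "rows_above m c \<le> x" for x c
    using less_rows_above_iff[OF anti(2), of x c] that by (auto simp: beta_num_def)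
  define cont :: "(nat \<times> nat) \<Rightarrow> int" where "cont = (\<lambda>(x, y). int y - int x)"
  define D where "D c = {p \<in> diagram l m. cont p = c}" for c
  have D_eq: "D c = (\<lambda>x. (x, nat (int x + c))) ` {rows_above m c..<rows_above l c}" for c
  proof (intro equalityI subsetI)
    fix p assume p: "p \<in> D c"
    obtain x y where [simp]: "p = (x, y)" by (cases p)
    have "int y - int x = c" "rows_above m c \<le> x" "x < rows_above l c"
      using p by (auto simp: D_def cont_def dia)
    then show "p \<in> (\<lambda>x. (x, nat (int x + c))) ` {rows_above m c..<rows_above l c}"
      by (intro image_eqI[of _ _ x]) auto
  next
    fix p assume "p \<in> (\<lambda>x. (x, nat (int x + c))) ` {rows_above m c..<rows_above l c}"
    then obtain x where x: "p = (x, nat (int x + c))" "rows_above m c \<le> x" "x < rows_above l c"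
      by auto
    then have "int (nat (int x + c)) - int x = c" using pos[of c x] by simp
    then show "p \<in> D c" using x by (simp add: D_def cont_def dia)
  qed
  have card_D: "card (D c) = d c" for c
    unfolding D_eq by (subst card_image) (auto simp: d_def inj_on_def)
  have fin_D: "finite (D c)" for c unfolding D_def using fin by simp
  have d_pos: "c \<in> cont ` diagram l m" if "0 < d c" for c
  proof -
    have "D c \<noteq> {}" using that card_D[of c] by auto
    then show ?thesis by (auto simp: D_def)
  qed
  \<comment> \<open>A content in both ranges or in neither leaves the length unchanged, so
    \<open>X\<close> consists of the contents where the diagonals get shorter.\<close>
  have X_iff: "c \<in> X \<longleftrightarrow> d c < d (c - 1)" for c
    using d_step[of c] by (auto simp: X_def split: if_splits)
  have d_X: "d (c - 1) = Suc (d c)" if "c \<in> X" for c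
    using d_step[of c] that by (auto simp: X_def)
  have "X \<subseteq> (\<lambda>c. c + 1) ` cont ` diagram l m"
  proof
    fix c assume "c \<in> X"
    then have "c - 1 \<in> cont ` diagram l m" using d_pos[of "c - 1"] by (simp add: X_iff)
    then show "c \<in> (\<lambda>c. c + 1) ` cont ` diagram l m" by (intro image_eqI[of _ _ "c - 1"]) auto
  qed
  then have fin_X: "finite X" by (rule finite_subset) (use fin in simp)
  show "skew_rank l m = card (range (beta_num l) - range (beta_num m))"
    unfolding X_def[symmetric]
  proof (rule skew_rank_eqI)
    \<comment> \<open>Number the cells of each diagonal from the south-east. The strips are the maximal runs of
      equally numbered cells on consecutive diagonals; the run numbered \<open>d a\<close> ending at content
      \<open>a - 1\<close> belongs to \<open>a \<in> X\<close>.\<close>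
    define I where "I a = {c. c < a \<and> (\<forall>c'. c \<le> c' \<and> c' < a \<longrightarrow> d a < d c')}" for a
    \<comment> \<open>Numbering starts at 0 in the last row \<open>rows_above l c - 1\<close>; the
      cell numbered \<open>d a\<close> lies \<open>d a\<close> rows higher and exists because
      \<open>d a < d c\<close>.\<close>
    define r where "r a c = rows_above l c - 1 - d a" for a c
    define S where "S a = (\<lambda>c. (r a c, nat (int (r a c) + c))) ` I a" for a
    have I_d: "d a < d c" if "c \<in> I a" for a c using that by (auto simp: I_def)
    have I_row: "rows_above m c \<le> r a c" "r a c < rows_above l c" if "c \<in> I a" for a c
      using I_d[OF that] le[of c] by (auto simp: r_def d_def)
    have S_iff: "(x, y) \<in> S a \<longleftrightarrow> int y - int x \<in> I a \<and> r a (int y - int x) = x" for x y a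
    proof
      assume "(x, y) \<in> S a"
      then obtain c where c: "c \<in> I a" "r a c = x" "nat (int (r a c) + c) = y" by (auto simp: S_def)
      then have "int y - int x = c" using pos[OF I_row(1)[OF c(1)]] by auto
      then show "int y - int x \<in> I a \<and> r a (int y - int x) = x" using c by simp
    next
      assume "int y - int x \<in> I a \<and> r a (int y - int x) = x"
      then show "(x, y) \<in> S a" by (auto simp: S_def intro!: image_eqI[of _ _ "int y - int x"])
    qed
    have strip: "border_strip (S a)" if a: "a \<in> X" for a
      unfolding S_def
    proof (rule border_strip_of_contents)
      have "I a \<subseteq> cont ` diagram l m" by (auto intro!: d_pos dest: I_d)
      then show "finite (I a)" by (rule finite_subset) (use fin in simp)
      have "a - 1 \<in> I a"
      proof -
        have "d a < d c'" if "a - 1 \<le> c'" "c' < a" for c'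
        proof -
          have "c' = a - 1" using that by simp
          then show ?thesis using d_X[OF a] by simp
        qed
        then show ?thesis by (simp add: I_def)
      qed
      then show "I a \<noteq> {}" by blast
      show "y \<in> I a" if "x \<in> I a" "z \<in> I a" "x \<le> y" "y \<le> z" for x y z
        using that by (auto simp: I_def)
      show "0 \<le> int (r a c) + c" if "c \<in> I a" for c using pos[OF I_row(1)[OF that]] .
      show "r a c = r a (c + 1) \<or> r a c = Suc (r a (c + 1))" if "c \<in> I a" "c + 1 \<in> I a" for c
        using rows_above_step[OF anti(1), of "c + 1"] I_d[OF that(1)] I_d[OF that(2)]
        by (auto simp: r_def d_def split: if_splits)
    qed
    \<comment> \<open>A common cell has only one number, so \<open>d a = d b\<close>; but
      \<open>a\<close> lies inside the run that ends before \<open>b\<close>, which gives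
      \<open>d b < d a\<close>.\<close>
    have disj: "S a \<inter> S b = {}" if "a < b" for a b
    proof (rule ccontr)
      assume "S a \<inter> S b \<noteq> {}"
      then obtain x y where "(x, y) \<in> S a" "(x, y) \<in> S b" by auto
      then have *: "int y - int x \<in> I a" "int y - int x \<in> I b"
        "r a (int y - int x) = r b (int y - int x)" by (auto simp: S_iff)
      have "d a = d b" using *(3) I_d[OF *(1)] I_d[OF *(2)] d_le[of "int y - int x"]
        unfolding r_def by linarith
      moreover have "d b < d a" using *(1,2) that by (auto simp: I_def)
      ultimately show False by simp
    qed
    have "\<Union> (S ` X) = diagram l m"
    proof (intro equalityI subsetI)
      fix p assume "p \<in> \<Union> (S ` X)"
      then obtain a x y where "p = (x, y)" "(x, y) \<in> S a" by (cases p) auto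
      then show "p \<in> diagram l m"
        using I_row[of "int y - int x" a] by (simp add: S_iff dia)
    next
      fix p assume p: "p \<in> diagram l m"
      obtain x y where [simp]: "p = (x, y)" by (cases p)
      define c where "c = int y - int x"
      have x: "rows_above m c \<le> x" "x < rows_above l c" using p by (auto simp: dia c_def)
      define k where "k = rows_above l c - 1 - x"
      have k: "k < d c" "rows_above l c - 1 - k = x" using x by (auto simp: k_def d_def)
      \<comment> \<open>From content \<open>l 0\<close> on, the diagonals are empty, so the run of
        cells numbered \<open>k\<close> has to end.\<close>
      have "c < int (l 0)"
        using less_rows_above_iff[OF anti(1), of 0 c] x by (auto simp: beta_num_def)
      moreover have "d (int (l 0)) = 0"
        using less_rows_above_iff[OF anti(1), of 0 "int (l 0)"] by (auto simp: beta_num_def d_def)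
      ultimately have ex: "\<exists>n. d (c + int n) \<le> k" by (intro exI[of _ "nat (int (l 0) - c)"]) simp
      \<comment> \<open>The content \<open>a = c + n\<close> is the first one from \<open>c\<close>
        on whose diagonal has no cell numbered \<open>k\<close>. Lengths drop by at most one, whence
        \<open>d a = k\<close> and the cell belongs to the strip of \<open>a\<close>.\<close>
      define n where "n = (LEAST n. d (c + int n) \<le> k)"
      define a where "a = c + int n"
      have da: "d a \<le> k" unfolding a_def n_def using ex by (rule LeastI_ex)
      have less: "k < d c'" if "c \<le> c'" "c' < a" for c'
        using not_less_Least[of "nat (c' - c)" "\<lambda>n. d (c + int n) \<le> k"] that
        by (simp add: a_def n_def[symmetric] nat_less_iff)
      have "n \<noteq> 0" using da k by (cases n) (auto simp: a_def)
      then have ca: "c < a" by (simp add: a_def)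
      then have "k < d (a - 1)" by (intro less) auto
      with da have aX: "a \<in> X" by (simp add: X_iff)
      have "d a = k" using d_X[OF aX] da \<open>k < d (a - 1)\<close> by simp
      then have "p \<in> S a" using ca less k by (simp add: S_iff I_def r_def c_def[symmetric])
      with aX show "p \<in> \<Union> (S ` X)" by blast
    qed
    moreover have "disjoint (S ` X)"
      using disj by (auto simp: disjoint_def) (metis IntI empty_iff linorder_neqE)+
    moreover have "{} \<notin> S ` X" using strip by (auto simp: border_strip_def)
    ultimately have "partition_on (diagram l m) (S ` X)" by (simp add: partition_on_def)
    moreover have "card (S ` X) \<le> card X" using fin_X by (rule card_image_le)
    ultimately show "\<exists>P. partition_on (diagram l m) P \<and> (\<forall>S\<in>P. border_strip S) \<and>
        finite P \<and> card P \<le> card X"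
      using strip fin_X by blast
  next
    fix P assume P: "partition_on (diagram l m) P" "\<forall>S\<in>P. border_strip S" "finite P"
    have uniq: "p = q" if "S \<in> P" "p \<in> S" "q \<in> S" "cont p = cont q" for S p q
      using border_strip_diagonal_unique[of S "fst p" "snd p" "fst q" "snd q"] P(2) that
      by (auto simp: cont_def split: prod.splits)
    \<comment> \<open>Pigeonhole: if every strip that meets content \<open>a - 1\<close> also met
      content \<open>a\<close>, moving along the strips would inject diagonal \<open>a - 1\<close>
      into the shorter diagonal \<open>a\<close>.\<close>
    have ex: "\<exists>S\<in>P. a - 1 \<in> cont ` S \<and> a \<notin> cont ` S" if a: "a \<in> X" for a
    proof (rule ccontr)
      assume neg: "\<not> ?thesis"
      have "\<forall>p\<in>D (a - 1). \<exists>q\<in>D a. \<exists>S\<in>P. p \<in> S \<and> q \<in> S"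
      proof
        fix p assume p: "p \<in> D (a - 1)"
        then obtain S where S: "S \<in> P" "p \<in> S"
          using P(1) by (auto simp: D_def partition_on_def)
        moreover from p S(2) have "a - 1 \<in> cont ` S"
          by (intro image_eqI[of _ _ p]) (auto simp: D_def)
        ultimately have "a \<in> cont ` S" using neg by blast
        then obtain q where q: "q \<in> S" "cont q = a" by blast
        then have "q \<in> D a" using P(1) S(1) by (auto simp: D_def partition_on_def)
        with S q show "\<exists>q\<in>D a. \<exists>S\<in>P. p \<in> S \<and> q \<in> S" by blast
      qed
      then obtain g where g: "\<And>p. p \<in> D (a - 1) \<Longrightarrow> g p \<in> D a \<and> (\<exists>S\<in>P. p \<in> S \<and> g p \<in> S)"
        by metis
      have "inj_on g (D (a - 1))"
      proof (rule inj_onI)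
        fix p q assume p: "p \<in> D (a - 1)" and q: "q \<in> D (a - 1)" and eq: "g p = g q"
        obtain S T where ST: "S \<in> P" "p \<in> S" "g p \<in> S" "T \<in> P" "q \<in> T" "g q \<in> T"
          using g[OF p] g[OF q] by blast
        then have "S = T" using P(1) eq by (auto simp: partition_on_def disjoint_def)
        then show "p = q" using uniq[OF ST(1), of p q] ST p q by (auto simp: D_def)
      qed
      then have "card (D (a - 1)) \<le> card (D a)"
        using g by (intro card_inj_on_le fin_D) auto
      then show False using a by (simp add: card_D X_iff)
    qed
    then obtain h where h: "\<And>a. a \<in> X \<Longrightarrow> h a \<in> P \<and> a - 1 \<in> cont ` h a \<and> a \<notin> cont ` h a"
      by metis
    \<comment> \<open>A strip serving both \<open>a\<close> and \<open>b\<close> would have the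
      contents \<open>a - 1\<close> and \<open>b - 1 >= a\<close>, hence also the content
      \<open>a\<close> that it avoids.\<close>
    have *: "h a \<noteq> h b" if ab: "a \<in> X" "b \<in> X" "a < b" for a b
    proof
      assume eq: "h a = h b"
      obtain p q where "p \<in> h a" "cont p = a - 1" "q \<in> h a" "cont q = b - 1"
        using h[OF ab(1)] h[OF ab(2)] unfolding eq by (metis (no_types, lifting) imageE)
      moreover have "border_strip (h a)" using h[OF ab(1)] P(2) by blast
      ultimately have "\<exists>(x, y)\<in>h a. int y - int x = a"
        using border_strip_contents_interval[of "h a" "fst p" "snd p" "fst q" "snd q" a] ab(3)
        by (simp add: cont_def split: prod.splits)
      then show False using h[OF ab(1)] by (force simp: cont_def)
    qed
    have "inj_on h X" by (rule linorder_inj_onI) (use * in auto)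
    then show "card X \<le> card P" using h P(3) by (intro card_inj_on_le) auto
  qed
qed

section \<open>Jacobi--Trudi determinant\<close>

text \<open>The complete homogeneous symmetric function at \<open>t\<close> ones, that is the
  binomial coefficient of \<open>t + k - 1\<close> over \<open>k\<close> as a polynomial in
  \<open>t\<close>.\<close>

definition h_poly :: "int \<Rightarrow> rat poly" where
  "h_poly k = (if k < 0 then 0
     else smult (1 / fact (nat k)) (\<Prod>i<nat k. [:of_nat i, 1:]))"

lemma h_poly_neg: "k < 0 \<Longrightarrow> h_poly k = 0"
  by (simp add: h_poly_def)

lemma poly_h_poly_of_nat:
  "poly (h_poly (int n)) x = (\<Prod>i<n. of_nat i + x) / fact n"
  by (simp add: h_poly_def poly_prod)

text \<open>Pascal's rule: monomials in one more variable either avoid the new variable or contain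
  it as a factor. All three terms share the product \<open>(x + 1) ... (x + n)\<close>, called
  \<open>Q\<close> below.\<close>

lemma poly_h_poly_step:
  "poly (h_poly k) (x + 1) - poly (h_poly (k - 1)) (x + 1) = poly (h_poly k) x"
proof -
  consider "k < 0" | "k = 0" | n where "k = int (Suc n)"
    by (metis int_cases3 not0_implies_Suc of_nat_0_less_iff neq0_conv neg_less_0_iff_less)
  then show ?thesis
  proof cases
    case 3
    define Q where "Q = (\<Prod>i<n. of_nat (Suc i) + x)"
    have 1: "(\<Prod>i<n. of_nat i + (x + 1)) = Q"
      unfolding Q_def by (intro prod.cong) auto
    have 2: "(\<Prod>i<Suc n. of_nat i + (x + 1)) = Q * (of_nat (Suc n) + x)"
      using 1 by (simp add: add_ac)
    have 3: "(\<Prod>i<Suc n. of_nat i + x) = x * Q"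
      unfolding prod.lessThan_Suc_shift Q_def by simp
    have k: "int (Suc n) - 1 = int n" by simp
    have "(fact (Suc n) :: rat) = of_nat (Suc n) * fact n" by simp
    then show ?thesis
      unfolding \<open>k = int (Suc n)\<close> k poly_h_poly_of_nat 1 2 3
      by (simp add: field_simps del: of_nat_Suc)
  qed (auto simp: h_poly_def)
qed

lemma poly_h_poly_sum:
  assumes "k' \<le> k"
  shows "poly (h_poly k) (x + 1) - poly (h_poly k') (x + 1) = (\<Sum>c\<in>{k'<..k}. poly (h_poly c) x)"
  using assms
proof (induction k rule: int_ge_induct)
  case (step k)
  have "{k'<..k + 1} = insert (k + 1) {k'<..k}" using step.hyps by auto
  then show ?case using step.IH poly_h_poly_step[of "k + 1" x] by simp
qed simp

section \<open>Row operations and expansions of determinants\<close>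

lemma det_sum_rows:
  fixes g :: "nat \<Rightarrow> 'b \<Rightarrow> nat \<Rightarrow> 'a :: comm_ring_1"
  assumes "\<And>i. i < N \<Longrightarrow> finite (S i)"
  shows "det (mat N N (\<lambda>(i, j). \<Sum>c\<in>S i. g i c j)) =
    (\<Sum>f\<in>Pi\<^sub>E {0..<N} S. det (mat N N (\<lambda>(i, j). g i (f i) j)))"
proof -
  have p: "p i < N" if "p permutes {0..<N}" "i < N" for p i
    using permutes_in_image[OF that(1), of i] that(2) by simp
  have "det (mat N N (\<lambda>(i, j). \<Sum>c\<in>S i. g i c j)) =
    (\<Sum>p | p permutes {0..<N}. signof p * (\<Prod>i = 0..<N. \<Sum>c\<in>S i. g i c (p i)))"
    by (subst det_def'[of _ N]) (auto intro!: sum.cong prod.cong simp: p)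
  also have "\<dots> = (\<Sum>p | p permutes {0..<N}. \<Sum>f\<in>Pi\<^sub>E {0..<N} S.
      signof p * (\<Prod>i = 0..<N. g i (f i) (p i)))"
    using assms by (subst prod_sum_PiE) (auto simp: sum_distrib_left)
  also have "\<dots> = (\<Sum>f\<in>Pi\<^sub>E {0..<N} S. \<Sum>p | p permutes {0..<N}.
      signof p * (\<Prod>i = 0..<N. g i (f i) (p i)))"
    by (rule sum.swap)
  also have "\<dots> = (\<Sum>f\<in>Pi\<^sub>E {0..<N} S. det (mat N N (\<lambda>(i, j). g i (f i) j)))"
    by (intro sum.cong refl, subst det_def'[of _ N]) (auto intro!: sum.cong prod.cong simp: p)
  finally show ?thesis .
qed

text \<open>The operation is left multiplication by the unitriangular matrix \<open>U\<close> with
  \<open>- 1\<close> just above the diagonal; the last row stays as it is.\<close>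

lemma det_subtract_next_row:
  fixes g :: "nat \<Rightarrow> nat \<Rightarrow> 'a :: comm_ring_1"
  shows "det (mat N N (\<lambda>(i, j). g i j - (if Suc i < N then g (Suc i) j else 0))) =
    det (mat N N (\<lambda>(i, j). g i j))"
proof -
  define U :: "'a mat" where
    "U = mat N N (\<lambda>(i, j). if i = j then 1 else if j = Suc i then - 1 else 0)"
  have U: "U \<in> carrier_mat N N" by (simp add: U_def)
  have "mat N N (\<lambda>(i, j). g i j - (if Suc i < N then g (Suc i) j else 0)) = U * mat N N (\<lambda>(i, j). g i j)"
  proof (rule eq_matI)
    fix i j assume "i < dim_row (U * mat N N (\<lambda>(i, j). g i j))"
      and "j < dim_col (U * mat N N (\<lambda>(i, j). g i j))"
    then have ij: "i < N" "j < N" by (auto simp: U_def)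
    have "(U * mat N N (\<lambda>(i, j). g i j)) $$ (i, j) =
      (\<Sum>k\<in>{0..<N}. (if i = k then 1 else if k = Suc i then - 1 else 0) * g k j)"
      using ij by (simp add: U_def scalar_prod_def)
    also have "\<dots> = (\<Sum>k\<in>{0..<N}. (if k = i then g i j else 0) - (if k = Suc i then g (Suc i) j else 0))"
      by (intro sum.cong) auto
    also have "\<dots> = g i j - (if Suc i < N then g (Suc i) j else 0)"
      using ij by (simp add: sum_subtractf)
    finally show "mat N N (\<lambda>(i, j). g i j - (if Suc i < N then g (Suc i) j else 0)) $$ (i, j) =
      (U * mat N N (\<lambda>(i, j). g i j)) $$ (i, j)"
      using ij by simp
  qed (auto simp: U_def)
  moreover have "det U = 1"
  proof -
    have "upper_triangular U" by (auto simp: U_def upper_triangular_def)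
    moreover have "diag_mat U = map (\<lambda>i. 1) [0..<N]"
      by (auto simp: diag_mat_def U_def)
    ultimately show ?thesis
      using det_upper_triangular[OF _ U] by (simp add: map_replicate_const)
  qed
  ultimately show ?thesis
    using det_mult[OF U, of "mat N N (\<lambda>(i, j). g i j)"] by simp
qed

lemma det_zero_row:
  fixes f :: "nat \<Rightarrow> nat \<Rightarrow> 'a :: comm_ring_1"
  assumes "i < N" "\<And>j. j < N \<Longrightarrow> f i j = 0"
  shows "det (mat N N (\<lambda>(i, j). f i j)) = 0"
proof -
  have "(\<Prod>k = 0..<N. mat N N (\<lambda>(i, j). f i j) $$ (k, p k)) = 0" if "p permutes {0..<N}" for p
    using assms permutes_in_image[OF that, of i] by (intro prod_zero) (auto intro!: bexI[of _ i])
  then show ?thesis by (subst det_def'[of _ N]) auto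
qed

lemma det_zero_column:
  fixes f :: "nat \<Rightarrow> nat \<Rightarrow> 'a :: comm_ring_1"
  assumes "j < N" "\<And>i. i < N \<Longrightarrow> f i j = 0"
  shows "det (mat N N (\<lambda>(i, j). f i j)) = 0"
proof -
  have "mat N N (\<lambda>(i, j). f i j) = transpose_mat (mat N N (\<lambda>(i, j). f j i))"
    by (intro eq_matI) auto
  then show ?thesis
    using det_transpose[of "mat N N (\<lambda>(i, j). f j i)" N] det_zero_row[OF assms(1), of "\<lambda>i j. f j i"]
      assms(2) by simp
qed

section \<open>Tableaux with bounded entries and removal of horizontal strips\<close>

definition ssyt_le :: "nat \<Rightarrow> (nat \<Rightarrow> nat) \<Rightarrow> (nat \<Rightarrow> nat) \<Rightarrow> (nat \<times> nat \<Rightarrow> nat) set" where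
  "ssyt_le t l m = {T \<in> ssyt l m. T ` diagram l m \<subseteq> {1..t}}"

text \<open>Interlacing means that \<open>l / n\<close> has at most one cell in each column. It also
  forces \<open>n\<close> to be a partition when \<open>l\<close> is one.\<close>

definition horizontal_strips :: "(nat \<Rightarrow> nat) \<Rightarrow> (nat \<Rightarrow> nat) set" where
  "horizontal_strips l = {n. \<forall>i. l (Suc i) \<le> n i \<and> n i \<le> l i}"

lemma ssyt_row_mono:
  assumes T: "T \<in> ssyt l m" and "m i \<le> j" "j \<le> k" "k < l i"
  shows "T (i, j) \<le> T (i, k)"
  using assms(3,4)
proof (induction k rule: dec_induct)
  case (step k)
  have "T (i, k) \<le> T (i, Suc k)"
    using T step assms(2) unfolding ssyt_def diagram_def by auto
  with step show ?case by simp
qed simp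

lemma horizontal_strips_partition:
  assumes l: "is_partition l" and n: "n \<in> horizontal_strips l"
  shows "is_partition n"
proof -
  have n': "l (Suc i) \<le> n i" "n i \<le> l i" for i using n by (auto simp: horizontal_strips_def)
  have "antimono n"
    by (rule antimonoI, erule lift_Suc_antimono_le[rotated]) (rule order_trans[OF n'(2) n'(1)])
  moreover have "finite {i. n i \<noteq> 0}"
  proof (rule finite_subset)
    show "{i. n i \<noteq> 0} \<subseteq> {i. l i \<noteq> 0}" using n'(2) by (metis (mono_tags) le_zero_eq mem_Collect_eq subsetI)
  qed (use l in \<open>simp add: is_partition_def\<close>)
  ultimately show ?thesis by (simp add: is_partition_def)
qed

lemma finite_horizontal_strips:
  assumes l: "is_partition l"
  shows "finite (horizontal_strips l)"
proof -
  have "finite {n. (\<forall>i. (i \<in> {i. l i \<noteq> 0} \<longrightarrow> n i \<in> {..l 0}) \<and> (i \<notin> {i. l i \<noteq> 0} \<longrightarrow> n i = (0::nat)))}"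
    using l by (intro finite_set_of_finite_funs) (auto simp: is_partition_def)
  then show ?thesis
  proof (rule finite_subset[rotated], intro subsetI CollectI allI conjI impI)
    fix n i assume n: "n \<in> horizontal_strips l"
    then have *: "n i \<le> l i" by (simp add: horizontal_strips_def)
    have "l i \<le> l 0" using l by (auto simp: is_partition_def dest: antimonoD)
    with * show "n i \<in> {..l 0}" by simp
    show "n i = 0" if "i \<notin> {i. l i \<noteq> 0}" using * that by simp
  qed
qed

text \<open>In a tableau with entries up to \<open>Suc t\<close>, the cells holding
  \<open>Suc t\<close> end their rows because rows increase weakly, and no two share a column
  because columns increase strictly. They form a horizontal strip, and what remains has entries up
  to \<open>t\<close>.\<close>

lemma ssyt_le_Suc:
  assumes sk: "skew_partition l m"
  shows "ssyt_le (Suc t) l m = (\<Union>n\<in>{n \<in> horizontal_strips l. \<forall>i. m i \<le> n i}.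
    (\<lambda>T c. if c \<in> diagram l m - diagram n m then Suc t else T c) ` ssyt_le t n m)"
proof (intro equalityI subsetI)
  have l: "is_partition l" and m: "is_partition m" and ml: "\<And>i. m i \<le> l i"
    using sk by (auto simp: skew_partition_def)
  have anti: "antimono l" "antimono m" using l m by (auto simp: is_partition_def)
  fix T assume "T \<in> ssyt_le (Suc t) l m"
  then have T: "T \<in> ssyt l m" "T ` diagram l m \<subseteq> {1..Suc t}" by (auto simp: ssyt_le_def)
  have bound: "1 \<le> T (i, j)" "T (i, j) \<le> Suc t" if "m i \<le> j" "j < l i" for i j
    using T(2) that unfolding image_subset_iff diagram_def by auto
  \<comment> \<open>The first column of row \<open>i\<close>, from \<open>m i\<close> on, with an
    entry above \<open>t\<close>; the guard \<open>j < l i\<close> makes it \<open>l i\<close> if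
    there is none.\<close>
  define n where "n i = (LEAST j. m i \<le> j \<and> (j < l i \<longrightarrow> t < T (i, j)))" for i
  have n: "m i \<le> n i" "n i < l i \<Longrightarrow> t < T (i, n i)" for i
    using LeastI[of "\<lambda>j. m i \<le> j \<and> (j < l i \<longrightarrow> t < T (i, j))" "l i"] ml[of i]
    by (auto simp: n_def)
  have n_le: "n i \<le> l i" for i
    unfolding n_def using ml[of i] by (intro Least_le) simp
  have small: "T (i, j) \<le> t" if "m i \<le> j" "j < n i" for i j
    using not_less_Least[of j "\<lambda>j. m i \<le> j \<and> (j < l i \<longrightarrow> t < T (i, j))"] that
    by (auto simp: n_def[symmetric] not_less)
  have large: "T (i, j) = Suc t" if "n i \<le> j" "j < l i" for i j
    using ssyt_row_mono[OF T(1), of i "n i" j] n[of i] that bound(2)[of i j] by simp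
  \<comment> \<open>Otherwise the cell below the entry \<open>Suc t\<close> at
    \<open>(i, n i)\<close> would hold a still larger entry.\<close>
  have strip: "l (Suc i) \<le> n i" for i
  proof (rule ccontr)
    assume neg: "\<not> ?thesis"
    have "l (Suc i) \<le> l i" "m (Suc i) \<le> m i" using anti by (auto intro: antimonoD)
    with neg n(1)[of i] have c: "(i, n i) \<in> diagram l m" "(Suc i, n i) \<in> diagram l m"
      by (auto simp: diagram_def)
    then have "T (i, n i) < T (Suc i, n i)" using T(1) unfolding ssyt_def by blast
    moreover have "T (i, n i) = Suc t" using c by (intro large) (auto simp: diagram_def)
    moreover have "T (Suc i, n i) \<le> Suc t" using c by (intro bound(2)) (auto simp: diagram_def)
    ultimately show False by simp
  qed
  define T' where "T' c = (if c \<in> diagram n m then T c else 0)" for c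
  have sub: "diagram n m \<subseteq> diagram l m" using n_le by (auto simp: diagram_def intro: less_le_trans)
  have "T' \<in> ssyt n m"
    unfolding ssyt_def
  proof (intro CollectI conjI allI impI ballI)
    show "1 \<le> T' c" if "c \<in> diagram n m" for c
      using that sub T(2) unfolding image_subset_iff by (auto simp: T'_def)
    show "T' (i, j) \<le> T' (i, Suc j)"
      if "(i, j) \<in> diagram n m \<and> (i, Suc j) \<in> diagram n m" for i j
      using that sub T(1) unfolding T'_def ssyt_def by (simp add: subset_iff)
    show "T' (i, j) < T' (Suc i, j)"
      if "(i, j) \<in> diagram n m \<and> (Suc i, j) \<in> diagram n m" for i j
      using that sub T(1) unfolding T'_def ssyt_def by (simp add: subset_iff)
  qed (simp add: T'_def)
  moreover have "T' ` diagram n m \<subseteq> {1..t}"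
  proof -
    have "1 \<le> T (i, j)" if "m i \<le> j" "j < n i" for i j
      using bound(1)[of i j] n_le[of i] that by simp
    then show ?thesis using small by (auto simp: T'_def diagram_def)
  qed
  ultimately have T': "T' \<in> ssyt_le t n m" by (simp add: ssyt_le_def)
  have "T = (\<lambda>c. if c \<in> diagram l m - diagram n m then Suc t else T' c)"
  proof (rule ext)
    fix c show "T c = (if c \<in> diagram l m - diagram n m then Suc t else T' c)"
      using T(1) sub large by (cases c) (auto simp: T'_def ssyt_def diagram_def)
  qed
  moreover have "n \<in> {n \<in> horizontal_strips l. \<forall>i. m i \<le> n i}"
    using n(1) n_le strip by (simp add: horizontal_strips_def)
  ultimately show "T \<in> (\<Union>n\<in>{n \<in> horizontal_strips l. \<forall>i. m i \<le> n i}.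
    (\<lambda>T c. if c \<in> diagram l m - diagram n m then Suc t else T c) ` ssyt_le t n m)"
    using T' by blast
next
  fix T assume "T \<in> (\<Union>n\<in>{n \<in> horizontal_strips l. \<forall>i. m i \<le> n i}.
    (\<lambda>T c. if c \<in> diagram l m - diagram n m then Suc t else T c) ` ssyt_le t n m)"
  then obtain n U where n: "\<And>i. l (Suc i) \<le> n i" "\<And>i. n i \<le> l i" "\<And>i. m i \<le> n i"
    and U: "U \<in> ssyt n m" "U ` diagram n m \<subseteq> {1..t}"
    and T: "T = (\<lambda>c. if c \<in> diagram l m - diagram n m then Suc t else U c)"
    by (auto simp: horizontal_strips_def ssyt_le_def)
  have U0: "U c = 0" if "c \<notin> diagram n m" for c using U(1) that by (cases c) (auto simp: ssyt_def)
  have Ut: "1 \<le> U c" "U c \<le> t" if "c \<in> diagram n m" for c using U(2) that by auto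
  have T_in: "T c = U c" if "c \<in> diagram n m" for c using that by (simp add: T)
  have T_out: "T c = Suc t" if "c \<in> diagram l m" "c \<notin> diagram n m" for c using that by (simp add: T)
  have T_le: "1 \<le> T c \<and> T c \<le> Suc t" if "c \<in> diagram l m" for c
    using T_in[of c] T_out[OF that] Ut[of c] by (cases "c \<in> diagram n m") auto
  have sub: "diagram n m \<subseteq> diagram l m" using n(2) by (auto simp: diagram_def intro: less_le_trans)
  have "T \<in> ssyt l m"
    unfolding ssyt_def
  proof (intro CollectI conjI allI impI ballI)
    show "T c = 0" if "c \<notin> diagram l m" for c using that sub U0[of c] by (auto simp: T)
    show "1 \<le> T c" if "c \<in> diagram l m" for c using T_le[OF that] by simp
    fix i j
    show "T (i, j) \<le> T (i, Suc j)" if *: "(i, j) \<in> diagram l m \<and> (i, Suc j) \<in> diagram l m"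
    proof (cases "(i, Suc j) \<in> diagram n m")
      case True
      then have "(i, j) \<in> diagram n m" using * by (auto simp: diagram_def)
      then show ?thesis using U(1) True by (auto simp: T_in ssyt_def)
    qed (use * T_le T_out in auto)
    show "T (i, j) < T (Suc i, j)" if *: "(i, j) \<in> diagram l m \<and> (Suc i, j) \<in> diagram l m"
    proof -
      have ij: "(i, j) \<in> diagram n m" using * n(1)[of i] by (auto simp: diagram_def)
      show ?thesis
      proof (cases "(Suc i, j) \<in> diagram n m")
        case True
        then show ?thesis using U(1) ij by (auto simp: T_in ssyt_def)
      next
        case False
        then show ?thesis using * Ut[OF ij] T_in[OF ij] T_out[of "(Suc i, j)"] by simp
      qed
    qed
  qed
  moreover have "T ` diagram l m \<subseteq> {1..Suc t}" using T_le by auto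
  ultimately show "T \<in> ssyt_le (Suc t) l m" by (simp add: ssyt_le_def)
qed

text \<open>The union is disjoint because a tableau determines \<open>n\<close>: the cells with
  entries up to \<open>t\<close> form \<open>diagram n m\<close>, and \<open>n\<close> can be read
  off from it since \<open>m\<close> lies below \<open>n\<close>.\<close>

lemma card_ssyt_le_Suc:
  assumes sk: "skew_partition l m"
  shows "card (ssyt_le (Suc t) l m) =
    (\<Sum>n\<in>{n \<in> horizontal_strips l. \<forall>i. m i \<le> n i}. card (ssyt_le t n m))"
proof -
  let ?H = "{n \<in> horizontal_strips l. \<forall>i. m i \<le> n i}"
  define E where "E n T c = (if c \<in> diagram l m - diagram n m then Suc t else T c)" for n T c
  have U: "ssyt_le (Suc t) l m = (\<Union>n\<in>?H. E n ` ssyt_le t n m)"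
    unfolding E_def by (rule ssyt_le_Suc[OF sk])
  have l: "is_partition l" and m: "is_partition m"
    using sk by (auto simp: skew_partition_def)
  have H_skew: "skew_partition n m" if "n \<in> ?H" for n
    using horizontal_strips_partition[OF l, of n] m that by (auto simp: skew_partition_def)
  have sub: "diagram n m \<subseteq> diagram l m" if "n \<in> ?H" for n
    using that by (auto simp: diagram_def horizontal_strips_def intro: less_le_trans)
  have fin: "finite (ssyt_le t n m)" if "n \<in> ?H" for n
    unfolding ssyt_le_def by (intro finite_ssyt_bounded finite_diagram H_skew that)
  have dia: "diagram n m = {c \<in> diagram l m. E n T c \<le> t}" if "n \<in> ?H" "T \<in> ssyt_le t n m" for n T
    using that sub[OF that(1)] by (auto simp: ssyt_le_def E_def)
  have n_eq: "n = n'" if H: "n \<in> ?H" "n' \<in> ?H" and eq: "diagram n m = diagram n' m" for n n'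
  proof (rule ext)
    fix i
    have "m i \<le> n i" "m i \<le> n' i" using H by auto
    moreover have "(i, j) \<in> diagram n m \<longleftrightarrow> (i, j) \<in> diagram n' m" for j using eq by simp
    then have "m i \<le> j \<and> j < n i \<longleftrightarrow> m i \<le> j \<and> j < n' i" for j by (simp add: diagram_def)
    from this[of "n i"] this[of "n' i"] show "n i = n' i" using calculation by auto
  qed
  have "card (ssyt_le (Suc t) l m) = (\<Sum>n\<in>?H. card (E n ` ssyt_le t n m))"
    unfolding U
  proof (rule card_UN_disjoint)
    show "finite ?H" using finite_horizontal_strips[OF l] by simp
    show "\<forall>n\<in>?H. finite (E n ` ssyt_le t n m)" by (intro ballI finite_imageI fin)
    show "\<forall>n\<in>?H. \<forall>n'\<in>?H. n \<noteq> n' \<longrightarrow> E n ` ssyt_le t n m \<inter> E n' ` ssyt_le t n' m = {}"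
    proof (intro ballI impI, rule ccontr)
      fix n n' assume H: "n \<in> ?H" "n' \<in> ?H" and ne: "n \<noteq> n'"
        and "E n ` ssyt_le t n m \<inter> E n' ` ssyt_le t n' m \<noteq> {}"
      then obtain R where R: "R \<in> E n ` ssyt_le t n m" "R \<in> E n' ` ssyt_le t n' m"
        by blast
      from R(1) obtain T where T: "T \<in> ssyt_le t n m" "R = E n T" by (rule imageE)
      from R(2) obtain T' where T': "T' \<in> ssyt_le t n' m" "R = E n' T'" by (rule imageE)
      have "diagram n m = diagram n' m"
        unfolding dia[OF H(1) T(1), folded T(2)] dia[OF H(2) T'(1), folded T'(2)] ..
      with n_eq[OF H] ne show False by simp
    qed
  qed
  also have "\<dots> = (\<Sum>n\<in>?H. card (ssyt_le t n m))"
  proof (intro sum.cong refl card_image inj_onI ext)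
    fix n T T' c
    assume T: "T \<in> ssyt_le t n m" "T' \<in> ssyt_le t n m" and eq: "E n T = E n T'"
    show "T c = T' c"
    proof (cases "c \<in> diagram n m")
      case True then show ?thesis using fun_cong[OF eq, of c] by (simp add: E_def)
    next
      case False then show ?thesis using T by (cases c) (auto simp: ssyt_le_def ssyt_def)
    qed
  qed
  finally show ?thesis .
qed

text \<open>At 0 only \<open>h_poly 0\<close> survives, so the entries compare beta numbers. If
  \<open>l\<close> and \<open>m\<close> first differ in row \<open>i\<close>, the larger of the two
  beta numbers there is missing from the other sequence, which yields a zero row or a zero
  column.\<close>

lemma det_h_poly_at_0:
  assumes l: "antimono l" "\<And>i. N \<le> i \<Longrightarrow> l i = 0" and m: "antimono m" "\<And>i. N \<le> i \<Longrightarrow> m i = 0"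
  shows "det (mat N N (\<lambda>(i, j). poly (h_poly (beta_num l i - beta_num m j)) 0)) =
    (if l = m then 1 else 0)"
proof -
  have h0: "poly (h_poly k) 0 = (if k = 0 then 1 else 0)" for k
  proof (cases "k \<le> 0")
    case False
    then obtain n where "k = int (Suc n)" by (metis not_le zero_less_imp_eq_int Suc_pred)
    then show ?thesis by (auto simp: poly_h_poly_of_nat prod.lessThan_Suc_shift simp del: of_nat_Suc)
  qed (auto simp: h_poly_def)
  show ?thesis
  proof (cases "l = m")
    case True
    then have "mat N N (\<lambda>(i, j). poly (h_poly (beta_num l i - beta_num m j)) 0) = 1\<^sub>m N"
      using inj_eq[OF inj_beta_num[OF m(1)]] by (intro eq_matI) (auto simp: h0)
    then show ?thesis using True by simp
  next
    case False
    define i where "i = (LEAST i. l i \<noteq> m i)"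
    have ne: "l i \<noteq> m i" unfolding i_def by (rule LeastI_ex) (use False in auto)
    have eq: "l k = m k" if "k < i" for k using not_less_Least that unfolding i_def by blast
    have iN: "i < N" using ne l(2) m(2) by (metis not_le)
    have less: "beta_num l' i \<noteq> beta_num m' j"
      if "antimono l'" "antimono m'" "m' i < l' i" "\<And>k. k < i \<Longrightarrow> l' k = m' k" for l' m' j
    proof (cases "j < i")
      case True
      then show ?thesis using beta_num_less[OF that(1) True] that(4)[OF True]
        by (simp add: beta_num_def)
    next
      case False
      then have "beta_num m' j \<le> beta_num m' i" using beta_num_le[OF that(2)] by simp
      then show ?thesis using that(3) by (simp add: beta_num_def)
    qed
    show ?thesis
    proof (cases "m i < l i")
      case True
      then show ?thesis using False less[OF l(1) m(1) True eq]
        by (subst det_zero_row[OF iN]) (auto simp: h0)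
    next
      case lt: False
      have "l i < m i" using lt ne by simp
      then have "beta_num l j \<noteq> beta_num m i" for j
        using less[OF m(1) l(1) _ eq[symmetric], of j] by metis
      then show ?thesis using False by (subst det_zero_column[OF iN]) (auto simp: h0)
    qed
  qed
qed

text \<open>Jacobi--Trudi at \<open>1\<^sup>t\<close>. Subtracting from each row the next one turns the entries for
  \<open>Suc t\<close> into sums of entries for \<open>t\<close>; expanding by rows then removes the horizontal strip of
  cells containing \<open>Suc t\<close>.\<close>

lemma card_ssyt_le_eq_det:
  assumes l: "is_partition l" "\<And>i. N \<le> i \<Longrightarrow> l i = 0"
    and m: "is_partition m" "\<And>i. N \<le> i \<Longrightarrow> m i = 0"
  shows "det (mat N N (\<lambda>(i, j). poly (h_poly (beta_num l i - beta_num m j)) (of_nat t))) =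
    (if \<forall>i. m i \<le> l i then of_nat (card (ssyt_le t l m)) else 0)"
  using l
\<comment> \<open>Removing a strip from \<open>l\<close> can leave a shape that no longer contains
  \<open>m\<close>. The claim therefore includes the value 0 for such shapes, and \<open>l\<close>
  is generalised.\<close>
proof (induction t arbitrary: l)
  case 0
  have anti: "antimono l" "antimono m" using 0 m by (auto simp: is_partition_def)
  show ?case
  proof (cases "l = m")
    case True
    have "diagram m m = {}" by (auto simp: diagram_def)
    then have "ssyt_le 0 m m = {\<lambda>_. 0}" by (auto simp: ssyt_le_def ssyt_def)
    then show ?thesis using True det_h_poly_at_0[OF anti(1) 0(2) anti(2) m(2)] by simp
  next
    case False
    have "card (ssyt_le 0 l m) = 0" if ml: "\<forall>i. m i \<le> l i"
    proof -
      obtain i where "l i \<noteq> m i" using False by auto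
      then have "(i, m i) \<in> diagram l m" using ml by (auto simp: diagram_def le_less)
      then have "ssyt_le 0 l m = {}" by (auto simp: ssyt_le_def)
      then show ?thesis by simp
    qed
    then show ?thesis using False det_h_poly_at_0[OF anti(1) 0(2) anti(2) m(2)] by simp
  qed
next
  case (Suc t)
  have anti: "antimono l" "antimono m" using Suc.prems m by (auto simp: is_partition_def)
  let ?x = "of_nat t :: rat"
  let ?S = "\<lambda>i. {l (Suc i)..l i}"
  let ?D = "\<lambda>n. det (mat N N (\<lambda>(i, j). poly (h_poly (beta_num n i - beta_num m j)) ?x))"
  let ?g = "\<lambda>i j. poly (h_poly (beta_num l i - beta_num m j)) (?x + 1)"
  have entry: "?g i j - (if Suc i < N then ?g (Suc i) j else 0) =
      (\<Sum>v\<in>?S i. poly (h_poly (int v - int i - beta_num m j)) ?x)" if ij: "i < N" "j < N" for i j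
  proof -
    \<comment> \<open>After the last row comes \<open>l N = 0\<close>, whose entries have negative
      index and vanish; so the last row follows the same pattern as the others.\<close>
    have "(if Suc i < N then ?g (Suc i) j else 0) = ?g (Suc i) j"
    proof (cases "Suc i < N")
      case False
      then have "beta_num l (Suc i) - beta_num m j < 0"
        using ij Suc.prems(2)[of "Suc i"] by (simp add: beta_num_def)
      then show ?thesis using False by (simp add: h_poly_neg)
    qed simp
    moreover have "?g i j - ?g (Suc i) j =
        (\<Sum>c\<in>{beta_num l (Suc i) - beta_num m j<..beta_num l i - beta_num m j}. poly (h_poly c) ?x)"
      using beta_num_le[OF anti(1), of i "Suc i"] by (intro poly_h_poly_sum) simp
    \<comment> \<open>The summation index becomes the new part \<open>v\<close> of row
      \<open>i\<close>. The half-open interval turns into the closed one because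
      \<open>beta_num l (Suc i)\<close> subtracts one more than row \<open>i\<close> does.\<close>
    moreover have "\<dots> = (\<Sum>v\<in>?S i. poly (h_poly (int v - int i - beta_num m j)) ?x)"
      by (rule sum.reindex_bij_witness[of _ "\<lambda>v. int v - int i - beta_num m j"
            "\<lambda>c. nat (c + beta_num m j + int i)"]) (auto simp: beta_num_def[of l])
    ultimately show ?thesis by simp
  qed
  have "det (mat N N (\<lambda>(i, j). poly (h_poly (beta_num l i - beta_num m j)) (of_nat (Suc t)))) =
      det (mat N N (\<lambda>(i, j). ?g i j))"
    by (simp add: add.commute)
  also have "\<dots> = det (mat N N (\<lambda>(i, j). ?g i j - (if Suc i < N then ?g (Suc i) j else 0)))"
    by (rule det_subtract_next_row[symmetric])
  also have "mat N N (\<lambda>(i, j). ?g i j - (if Suc i < N then ?g (Suc i) j else 0)) =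
      mat N N (\<lambda>(i, j). \<Sum>v\<in>?S i. poly (h_poly (int v - int i - beta_num m j)) ?x)"
    by (intro eq_matI) (auto simp: entry simp del: if_split)
  also have "det \<dots> = (\<Sum>f\<in>Pi\<^sub>E {0..<N} ?S.
      det (mat N N (\<lambda>(i, j). poly (h_poly (int (f i) - int i - beta_num m j)) ?x)))"
    by (rule det_sum_rows) simp
  also have "\<dots> = (\<Sum>n\<in>horizontal_strips l. ?D n)"
  proof (rule sum.reindex_bij_witness[of _ "\<lambda>n. restrict n {0..<N}" "\<lambda>f i. if i < N then f i else 0"])
    fix f assume f: "f \<in> Pi\<^sub>E {0..<N} ?S"
    show "restrict (\<lambda>i. if i < N then f i else 0) {0..<N} = f"
      using f by (auto simp: PiE_def extensional_def restrict_def)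
    show "(\<lambda>i. if i < N then f i else 0) \<in> horizontal_strips l"
      using f Suc.prems(2) by (auto simp: horizontal_strips_def PiE_iff)
    show "?D (\<lambda>i. if i < N then f i else 0) =
        det (mat N N (\<lambda>(i, j). poly (h_poly (int (f i) - int i - beta_num m j)) ?x))"
      by (intro arg_cong[where f = det] eq_matI) (auto simp: beta_num_def[of "\<lambda>i. if i < N then f i else 0"])
  next
    fix n assume n: "n \<in> horizontal_strips l"
    have "n i = 0" if "N \<le> i" for i
      using n Suc.prems(2)[OF that] by (auto simp: horizontal_strips_def dest: spec[of _ i])
    then show "(\<lambda>i. if i < N then restrict n {0..<N} i else 0) = n" by (auto simp: fun_eq_iff)
    show "restrict n {0..<N} \<in> Pi\<^sub>E {0..<N} ?S" using n by (auto simp: horizontal_strips_def)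
  qed
  also have "\<dots> = (\<Sum>n\<in>horizontal_strips l. if \<forall>i. m i \<le> n i then of_nat (card (ssyt_le t n m)) else 0)"
  proof (intro sum.cong refl Suc.IH)
    fix n i assume n: "n \<in> horizontal_strips l"
    then show "is_partition n" by (rule horizontal_strips_partition[OF Suc.prems(1)])
    show "n i = 0" if "N \<le> i"
      using n Suc.prems(2)[OF that] by (auto simp: horizontal_strips_def dest: spec[of _ i])
  qed
  also have "\<dots> = (\<Sum>n\<in>{n \<in> horizontal_strips l. \<forall>i. m i \<le> n i}. of_nat (card (ssyt_le t n m)))"
    using finite_horizontal_strips[OF Suc.prems(1)]
    by (simp only: sum.inter_filter[symmetric])
  also have "\<dots> = (if \<forall>i. m i \<le> l i then of_nat (card (ssyt_le (Suc t) l m)) else 0)"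
  proof (cases "\<forall>i. m i \<le> l i")
    case True
    then have "skew_partition l m" using Suc.prems m by (simp add: skew_partition_def)
    from card_ssyt_le_Suc[OF this, of t] True show ?thesis by simp
  next
    case False
    then have none: "{n \<in> horizontal_strips l. \<forall>i. m i \<le> n i} = {}"
      by (auto simp: horizontal_strips_def) (meson order_trans)
    show ?thesis unfolding none using False by auto
  qed
  finally show ?case .
qed

section \<open>Lowest coefficient of the determinant\<close>

lemma poly_det:
  fixes f :: "nat \<Rightarrow> nat \<Rightarrow> 'a :: comm_ring_1 poly"
  shows "poly (det (mat N N (\<lambda>(i, j). f i j))) x = det (mat N N (\<lambda>(i, j). poly (f i j) x))"
proof -
  have p: "p i < N" if "p permutes {0..<N}" "i < N" for p i
    using permutes_in_image[OF that(1), of i] that(2) by simp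
  have s: "poly (signof p) x = signof p" for p :: "nat \<Rightarrow> nat"
    by (simp add: sign_def)
  show ?thesis
    by (subst (1 2) det_def'[of _ N]) (auto simp: poly_sum poly_prod s p intro!: sum.cong prod.cong)
qed

lemma det_scale_rows:
  fixes f :: "nat \<Rightarrow> nat \<Rightarrow> 'a :: comm_ring_1"
  shows "det (mat N N (\<lambda>(i, j). c i * f i j)) = (\<Prod>i<N. c i) * det (mat N N (\<lambda>(i, j). f i j))"
proof -
  have p: "p i < N" if "p permutes {0..<N}" "i < N" for p i
    using permutes_in_image[OF that(1), of i] that(2) by simp
  show ?thesis
    by (subst (1 2) det_def'[of _ N])
      (auto simp: sum_distrib_left prod.distrib p atLeast0LessThan mult_ac intro!: sum.cong prod.cong)
qed

text \<open>A kernel vector indexed by column labels makes singularity depend on the label sets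
  alone, so orderings and the signs they cause disappear.\<close>

definition singular_on :: "('a \<Rightarrow> 'b \<Rightarrow> rat) \<Rightarrow> 'a set \<Rightarrow> 'b set \<Rightarrow> bool" where
  "singular_on F X Y \<longleftrightarrow>
     (\<exists>v. (\<exists>y\<in>Y. v y \<noteq> 0) \<and> (\<forall>x\<in>X. (\<Sum>y\<in>Y. F x y * v y) = 0))"

lemma det_eq_0_iff_singular_on:
  assumes b: "inj_on b {..<n}"
  shows "det (mat n n (\<lambda>(i, j). F (a i) (b j))) = 0 \<longleftrightarrow> singular_on F (a ` {..<n}) (b ` {..<n})"
proof -
  let ?M = "mat n n (\<lambda>(i, j). F (a i) (b j))"
  have row: "(?M *\<^sub>v v) $ i = (\<Sum>j<n. F (a i) (b j) * v $ j)"
    if "i < n" "v \<in> carrier_vec n" for v i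
    using that by (simp add: scalar_prod_def atLeast0LessThan)
  have "det ?M = 0 \<longleftrightarrow> (\<exists>v. v \<in> carrier_vec n \<and> v \<noteq> 0\<^sub>v n \<and> ?M *\<^sub>v v = 0\<^sub>v n)"
    by (rule det_0_iff_vec_prod_zero) simp
  also have "\<dots> \<longleftrightarrow> singular_on F (a ` {..<n}) (b ` {..<n})"
  proof
    assume "\<exists>v. v \<in> carrier_vec n \<and> v \<noteq> 0\<^sub>v n \<and> ?M *\<^sub>v v = 0\<^sub>v n"
    then obtain v where v: "v \<in> carrier_vec n" "v \<noteq> 0\<^sub>v n" "?M *\<^sub>v v = 0\<^sub>v n" by blast
    then obtain j where j: "j < n" "v $ j \<noteq> 0" by (metis carrier_vecD eq_vecI index_zero_vec)
    define w where "w y = v $ the_inv_into {..<n} b y" for y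
    have w: "w (b j) = v $ j" if "j < n" for j
      using the_inv_into_f_f[OF b] that by (simp add: w_def)
    have "(\<Sum>y\<in>b ` {..<n}. F (a i) y * w y) = 0" if "i < n" for i
    proof -
      have "(\<Sum>y\<in>b ` {..<n}. F (a i) y * w y) = (\<Sum>j<n. F (a i) (b j) * v $ j)"
        by (subst sum.reindex[OF b]) (simp add: w)
      also have "\<dots> = (?M *\<^sub>v v) $ i" using row[OF that v(1)] by simp
      finally show ?thesis using v(3) that by simp
    qed
    moreover have "\<exists>y\<in>b ` {..<n}. w y \<noteq> 0" using j w[OF j(1)] by (intro bexI[of _ "b j"]) auto
    ultimately show "singular_on F (a ` {..<n}) (b ` {..<n})"
      unfolding singular_on_def by blast
  next
    assume "singular_on F (a ` {..<n}) (b ` {..<n})"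
    then obtain w j where w: "j < n" "w (b j) \<noteq> 0"
      "\<And>i. i < n \<Longrightarrow> (\<Sum>y\<in>b ` {..<n}. F (a i) y * w y) = 0"
      unfolding singular_on_def by auto
    define v where "v = vec n (\<lambda>j. w (b j))"
    have v: "v \<in> carrier_vec n" by (simp add: v_def)
    have "v $ j \<noteq> 0" using w by (simp add: v_def)
    then have "v \<noteq> 0\<^sub>v n" using w(1) by auto
    moreover have "?M *\<^sub>v v = 0\<^sub>v n"
    proof (rule eq_vecI)
      fix i assume "i < dim_vec (0\<^sub>v n :: rat vec)"
      then have i: "i < n" by simp
      have "(?M *\<^sub>v v) $ i = (\<Sum>j<n. F (a i) (b j) * w (b j))"
        unfolding row[OF i v] by (intro sum.cong) (auto simp: v_def)
      also have "\<dots> = 0" using w(3)[OF i] by (simp add: sum.reindex[OF b])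
      finally show "(?M *\<^sub>v v) $ i = 0\<^sub>v n $ i" using i by simp
    qed simp
    ultimately show "\<exists>v. v \<in> carrier_vec n \<and> v \<noteq> 0\<^sub>v n \<and> ?M *\<^sub>v v = 0\<^sub>v n" using v by blast
  qed
  finally show ?thesis .
qed

text \<open>A unit row at \<open>x\<close> forces a kernel vector to vanish at \<open>x\<close>. The
  remaining rows and coordinates give the smaller system, and extension by zero leads back.\<close>

lemma singular_on_unit_rows:
  assumes "finite B"
  shows "singular_on (\<lambda>x y. if x \<in> B then (if x = y then 1 else 0) else F x y) A B \<longleftrightarrow>
    singular_on F (A - B) (B - A)"
proof
  assume "singular_on (\<lambda>x y. if x \<in> B then (if x = y then 1 else 0) else F x y) A B"
  then obtain v z where z: "z \<in> B" "v z \<noteq> 0"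
    and v: "\<And>x. x \<in> A \<Longrightarrow> (\<Sum>y\<in>B. (if x \<in> B then (if x = y then 1 else 0) else F x y) * v y) = 0"
    unfolding singular_on_def by blast
  have v0: "v x = 0" if x: "x \<in> A" "x \<in> B" for x
  proof -
    have "v x = (\<Sum>y\<in>B. if x = y then v y else 0)" using x assms by simp
    also have "\<dots> = (\<Sum>y\<in>B. (if x \<in> B then (if x = y then 1 else 0) else F x y) * v y)"
      using x by (intro sum.cong) auto
    finally show ?thesis using v[OF x(1)] by simp
  qed
  have "(\<Sum>y\<in>B - A. F x y * v y) = 0" if x: "x \<in> A - B" for x
  proof -
    have "(\<Sum>y\<in>B - A. F x y * v y) = (\<Sum>y\<in>B. F x y * v y)"
      using assms v0 by (intro sum.mono_neutral_left) auto
    then show ?thesis using v[of x] x by simp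
  qed
  moreover have "z \<in> B - A" using z v0 by blast
  ultimately show "singular_on F (A - B) (B - A)" unfolding singular_on_def using z(2) by blast
next
  assume "singular_on F (A - B) (B - A)"
  then obtain v z where z: "z \<in> B - A" "v z \<noteq> 0"
    and v: "\<And>x. x \<in> A - B \<Longrightarrow> (\<Sum>y\<in>B - A. F x y * v y) = 0"
    unfolding singular_on_def by blast
  define w where "w y = (if y \<in> B - A then v y else 0)" for y
  have "(\<Sum>y\<in>B. (if x \<in> B then (if x = y then 1 else 0) else F x y) * w y) = 0" if x: "x \<in> A" for x
  proof (cases "x \<in> B")
    case True
    then show ?thesis using x by (intro sum.neutral) (auto simp: w_def)
  next
    case False
    have "(\<Sum>y\<in>B. F x y * w y) = (\<Sum>y\<in>B - A. F x y * v y)"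
      using assms by (intro sum.mono_neutral_cong_right) (auto simp: w_def)
    then show ?thesis using v[of x] x False by simp
  qed
  moreover have "w z \<noteq> 0" using z by (simp add: w_def)
  ultimately show "singular_on (\<lambda>x y. if x \<in> B then (if x = y then 1 else 0) else F x y) A B"
    unfolding singular_on_def using z(1) by blast
qed

section \<open>Order of vanishing at 0 and the Cauchy entries\<close>

definition cauchy_entry :: "int \<Rightarrow> int \<Rightarrow> rat" where
  "cauchy_entry x y = (if x > y then 1 / of_int (x - y) else 0)"

text \<open>For positive \<open>k\<close> the factor for \<open>i = 0\<close> is \<open>t\<close>,
  and the others give \<open>(k - 1)! / k! = 1 / k\<close> at 0. Thus the linear coefficient is a
  Cauchy entry.\<close>

lemma h_poly_nonzero_index:
  assumes "k \<noteq> 0"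
  shows "\<exists>q. h_poly k = [:0, 1:] * q \<and> poly q 0 = (if k > 0 then 1 / of_int k else 0)"
proof (cases "k < 0")
  case False
  with assms obtain n where k: "k = int (Suc n)"
    by (metis linorder_neqE_linordered_idom zero_less_imp_eq_int Suc_pred)
  let ?q = "smult (1 / fact (Suc n)) (\<Prod>i<n. [:of_nat (Suc i), 1:]) :: rat poly"
  have "h_poly k = [:0, 1:] * ?q"
    unfolding h_poly_def k nat_int prod.lessThan_Suc_shift by simp
  moreover have "poly ?q 0 = 1 / of_int k"
  proof -
    have "poly ?q 0 = 1 / fact (Suc n) * (\<Prod>i<n. of_nat (Suc i))"
      by (simp add: poly_prod)
    also have "(\<Prod>i<n. of_nat (Suc i) :: rat) = fact n"
      by (simp add: fact_prod_Suc atLeast0LessThan)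
    also have "1 / fact (Suc n) * fact n = (1 / of_nat (Suc n) :: rat)"
      unfolding fact_Suc by (simp add: field_simps del: of_nat_Suc)
    finally show ?thesis unfolding k by (simp del: of_nat_Suc)
  qed
  ultimately show ?thesis using k by auto
qed (simp add: h_poly_neg)

text \<open>Both polynomials count tableaux at every natural number, so uniqueness identifies
  them.\<close>

lemma schur_poly_eq_det:
  assumes sk: "skew_partition l m" and N: "\<forall>i\<ge>N. l i = 0"
  shows "schur_poly l m = det (mat N N (\<lambda>(i, j). h_poly (beta_num l i - beta_num m j)))"
    and "schur_poly l m \<noteq> 0"
proof -
  let ?P = "det (mat N N (\<lambda>(i, j). h_poly (beta_num l i - beta_num m j)))"
  have l: "is_partition l" and m: "is_partition m" and ml: "\<And>i. m i \<le> l i"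
    using sk by (auto simp: skew_partition_def)
  have mN: "m i = 0" if "N \<le> i" for i using ml[of i] N that by simp
  have P: "poly ?P (of_nat t) = of_nat (card (ssyt_le t l m))" for t
    using card_ssyt_le_eq_det[where t = t, OF l _ m, of N] ml N mN by (simp add: poly_det)
  have "\<forall>t. poly ?P (of_nat t) = skew_schur l m (principal t)"
    unfolding P skew_schur_principal[OF finite_diagram[OF sk]] ssyt_le_def by simp
  then show eq: "schur_poly l m = ?P"
    unfolding schur_poly_def by (rule the1_equality[OF schur_poly_ex1[OF sk]])
  \<comment> \<open>Filling every cell with its row number, counted from 1, gives a tableau with
    entries up to \<open>N\<close>; hence the value at \<open>N\<close> is positive.\<close>
  have "(\<lambda>c. if c \<in> diagram l m then Suc (fst c) else 0) \<in> ssyt_le N l m"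
    using N by (auto simp: ssyt_le_def ssyt_def) (auto simp: diagram_def Suc_le_eq intro: ccontr)
  moreover have "finite (ssyt_le N l m)"
    unfolding ssyt_le_def by (intro finite_ssyt_bounded finite_diagram sk)
  ultimately have "card (ssyt_le N l m) \<noteq> 0" by auto
  then show "schur_poly l m \<noteq> 0" unfolding eq using P[of N] by auto
qed

lemma zrank_eq_order:
  assumes "schur_poly l m \<noteq> 0"
  shows "zrank l m = order 0 (schur_poly l m)"
  unfolding zrank_def
proof (rule Greatest_equality)
  show "[:0, 1:] ^ order 0 (schur_poly l m) dvd schur_poly l m"
    using order_1[of 0 "schur_poly l m"] by simp
  show "e \<le> order 0 (schur_poly l m)" if "[:0, 1:] ^ e dvd schur_poly l m" for e
    using order_divides[of 0 e "schur_poly l m"] that assms by simp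
qed

text \<open>From row \<open>N\<close> on both sequences are \<open>- i\<close> and cancel, while
  earlier rows have beta numbers above \<open>- N\<close> and never meet this tail.\<close>

lemma range_beta_num_diff:
  assumes N: "\<And>i. N \<le> i \<Longrightarrow> l i = 0" "\<And>i. N \<le> i \<Longrightarrow> m i = 0"
  shows "range (beta_num l) - range (beta_num m) = beta_num l ` {..<N} - beta_num m ` {..<N}"
proof -
  have eq: "beta_num l i = beta_num m i" if "N \<le> i" for i
    using that by (simp add: beta_num_def N)
  have 1: "beta_num l i \<in> beta_num m ` {..<N}" if "i < N" "beta_num l i = beta_num m j" for i j
    using that N(2)[of j] by (cases "j < N") (auto simp: beta_num_def image_iff)
  have 2: "i < N" if "beta_num l i \<notin> range (beta_num m)" for i
    using eq[of i] that by (metis not_less rangeI)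
  show ?thesis
  proof (intro equalityI subsetI DiffI)
    fix x assume "x \<in> range (beta_num l) - range (beta_num m)"
    then show "x \<in> beta_num l ` {..<N}" "x \<notin> beta_num m ` {..<N}" using 2 by auto
  next
    fix x assume "x \<in> beta_num l ` {..<N} - beta_num m ` {..<N}"
    then show "x \<in> range (beta_num l)" "x \<notin> range (beta_num m)" using 1 by auto
  qed
qed

text \<open>Dividing the rows without an entry \<open>h\<^sub>0 = 1\<close> by \<open>t\<close> and then setting \<open>t = 0\<close> leaves the
  Cauchy entries in these rows and unit vectors in the others.\<close>

lemma skew_rank_eq_zrank_iff:
  fixes l m N
  defines "A \<equiv> beta_num l ` {..<N}" and "B \<equiv> beta_num m ` {..<N}"
  assumes sk: "skew_partition l m" and N: "\<forall>i\<ge>N. l i = 0"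
  shows "skew_rank l m = zrank l m \<longleftrightarrow> \<not> singular_on cauchy_entry (A - B) (B - A)"
proof -
  have anti: "antimono l" "antimono m" and ml: "\<And>i. m i \<le> l i"
    using sk by (auto simp: skew_partition_def is_partition_def)
  have mN: "m i = 0" if "N \<le> i" for i using ml[of i] N that by simp
  have rank: "skew_rank l m = card (A - B)"
    using skew_rank_eq_card[OF sk] range_beta_num_diff[of N l m] N mN by (simp add: A_def B_def)
  \<comment> \<open>Here \<open>q k\<close> is \<open>h_poly k\<close> divided by \<open>t\<close>.
    It is used only in rows outside \<open>B\<close>, where the index is never 0.\<close>
  obtain q where q: "\<And>k. k \<noteq> 0 \<Longrightarrow> h_poly k = [:0, 1:] * q k"
    "\<And>k. k \<noteq> 0 \<Longrightarrow> poly (q k) 0 = (if k > 0 then 1 / of_int k else 0)"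
    using h_poly_nonzero_index by metis
  define g where "g i j = (if beta_num l i \<in> B then h_poly (beta_num l i - beta_num m j)
    else q (beta_num l i - beta_num m j))" for i j
  define Q where "Q = det (mat N N (\<lambda>(i, j). g i j))"
  note P = schur_poly_eq_det[OF sk N]
  have "schur_poly l m =
      det (mat N N (\<lambda>(i, j). (if beta_num l i \<in> B then 1 else [:0, 1:]) * g i j))"
    unfolding P(1)
  proof (intro arg_cong[where f = det] eq_matI)
    fix i j assume "i < dim_row (mat N N (\<lambda>(i, j). (if beta_num l i \<in> B then 1 else [:0, 1:]) * g i j))"
      and "j < dim_col (mat N N (\<lambda>(i, j). (if beta_num l i \<in> B then 1 else [:0, 1:]) * g i j))"
    then have ij: "i < N" "j < N" by auto
    then have "beta_num m j \<in> B" by (simp add: B_def)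
    then have "beta_num l i - beta_num m j \<noteq> 0" if "beta_num l i \<notin> B" using that by auto
    then show "mat N N (\<lambda>(i, j). h_poly (beta_num l i - beta_num m j)) $$ (i, j) =
        mat N N (\<lambda>(i, j). (if beta_num l i \<in> B then 1 else [:0, 1:]) * g i j) $$ (i, j)"
      using ij q(1) by (auto simp: g_def)
  qed auto
  also have "\<dots> = (\<Prod>i<N. if beta_num l i \<in> B then 1 else [:0, 1:]) * Q"
    unfolding Q_def by (rule det_scale_rows)
  also have "(\<Prod>i<N. if beta_num l i \<in> B then 1 else [:0, 1:]) =
      (\<Prod>x\<in>A. if x \<in> B then 1 else [:0, 1 :: rat:])"
    unfolding A_def by (subst prod.reindex) (auto intro: inj_on_subset[OF inj_beta_num[OF anti(1)]])
  also have "\<dots> = (\<Prod>x\<in>A - B. [:0, 1:])"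
    by (rule prod.mono_neutral_cong_right) (auto simp: A_def)
  finally have fact: "schur_poly l m = [:0, 1:] ^ card (A - B) * Q" by simp
  have ne: "schur_poly l m \<noteq> 0" using P(2) .
  then have "Q \<noteq> 0" unfolding fact by auto
  have "zrank l m = card (A - B) + order 0 Q"
    using ne order_power_n_n[of 0 "card (A - B)"]
    unfolding zrank_eq_order[OF ne] fact by (simp add: order_mult)
  \<comment> \<open>The exponent split off is already the rank, so equality means that
    \<open>Q\<close> has no further zero at 0.\<close>
  then have "skew_rank l m = zrank l m \<longleftrightarrow> poly Q 0 \<noteq> 0"
    using rank order_root[of Q 0] \<open>Q \<noteq> 0\<close> by auto
  also have "poly Q 0 = det (mat N N (\<lambda>(i, j). poly (g i j) 0))"
    unfolding Q_def by (rule poly_det)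
  also have "mat N N (\<lambda>(i, j). poly (g i j) 0) = mat N N (\<lambda>(i, j).
      (\<lambda>x y. if x \<in> B then (if x = y then 1 else 0) else cauchy_entry x y) (beta_num l i) (beta_num m j))"
  proof (rule eq_matI)
    fix i j assume "i < dim_row (mat N N (\<lambda>(i, j).
      (\<lambda>x y. if x \<in> B then (if x = y then 1 else 0) else cauchy_entry x y) (beta_num l i) (beta_num m j)))"
      and "j < dim_col (mat N N (\<lambda>(i, j).
      (\<lambda>x y. if x \<in> B then (if x = y then 1 else 0) else cauchy_entry x y) (beta_num l i) (beta_num m j)))"
    then have ij: "i < N" "j < N" by auto
    have h0: "poly (h_poly k) 0 = (if k = 0 then 1 else 0)" for k
      using q(1)[of k] by (cases "k = 0") (auto simp: h_poly_def)
    have "beta_num m j \<in> B" using ij by (simp add: B_def)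
    then have "beta_num l i - beta_num m j \<noteq> 0" if "beta_num l i \<notin> B" using that by auto
    then have "poly (g i j) 0 = (if beta_num l i \<in> B then (if beta_num l i = beta_num m j then 1 else 0)
        else cauchy_entry (beta_num l i) (beta_num m j))"
      by (simp add: g_def h0 q(2) cauchy_entry_def)
    then show "mat N N (\<lambda>(i, j). poly (g i j) 0) $$ (i, j) = mat N N (\<lambda>(i, j).
      (\<lambda>x y. if x \<in> B then (if x = y then 1 else 0) else cauchy_entry x y)
        (beta_num l i) (beta_num m j)) $$ (i, j)"
      using ij by simp
  qed auto
  also have "det \<dots> \<noteq> 0 \<longleftrightarrow>
      \<not> singular_on (\<lambda>x y. if x \<in> B then (if x = y then 1 else 0) else cauchy_entry x y) A B"
    unfolding A_def B_def
    by (subst det_eq_0_iff_singular_on) (auto intro: inj_on_subset[OF inj_beta_num[OF anti(2)]])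
  also have "\<dots> \<longleftrightarrow> \<not> singular_on cauchy_entry (A - B) (B - A)"
    by (subst singular_on_unit_rows) (auto simp: B_def)
  finally show ?thesis .
qed

section \<open>Restricted Cauchy matrices and skew partitions\<close>

text \<open>Adding \<open>i\<close> inverts \<open>beta_num\<close>: strict decrease of integers
  becomes weak decrease of parts, and nonnegativity allows the continuation by zeros.\<close>

lemma strictly_decreasing_partition:
  fixes a :: "nat \<Rightarrow> int"
  assumes dec: "\<And>i j. i < j \<Longrightarrow> j < n \<Longrightarrow> a j < a i" and pos: "\<And>i. i < n \<Longrightarrow> 0 \<le> a i"
  defines "l \<equiv> \<lambda>i. if i < n then nat (a i + int i) else 0"
  shows "is_partition l" and "\<And>i. i < n \<Longrightarrow> beta_num l i = a i"
proof -
  have "l (Suc i) \<le> l i" for i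
    using dec[of i "Suc i"] by (auto simp: l_def)
  then have "antimono l" by (intro antimonoI) (rule lift_Suc_antimono_le)
  moreover have "finite {i. l i \<noteq> 0}"
    by (rule finite_subset[of _ "{..<n}"]) (auto simp: l_def split: if_splits)
  ultimately show "is_partition l" by (simp add: is_partition_def)
  show "beta_num l i = a i" if "i < n" for i using pos[OF that] that by (simp add: beta_num_def l_def)
qed

lemma enumerate_increasing:
  fixes X :: "'a :: linorder set"
  assumes "finite X"
  obtains x :: "nat \<Rightarrow> 'a" where "strict_mono_on {..<card X} x" "x ` {..<card X} = X"
proof
  let ?xs = "sorted_list_of_set X"
  show "strict_mono_on {..<card X} (\<lambda>i. ?xs ! i)"
    using strict_sorted_list_of_set[of X]
    by (intro strict_mono_onI) (auto simp: sorted_wrt_iff_nth_less)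
  show "(\<lambda>i. ?xs ! i) ` {..<card X} = X"
    using assms by (metis atLeast_upt length_sorted_list_of_set list.set_map map_nth set_sorted_list_of_set)
qed

text \<open>Dominance of the counts above every threshold orders the enumerations termwise. If
  \<open>x k < y k\<close>, then at threshold \<open>x k\<close> at least \<open>n - k\<close>
  values of \<open>y\<close> lie above, but at most \<open>n - k - 1\<close> values of
  \<open>x\<close>.\<close>

lemma increasing_enumerations_less:
  fixes x y :: "nat \<Rightarrow> int"
  assumes x: "strict_mono_on {..<n} x" and y: "strict_mono_on {..<n} y"
    and ne: "\<And>i j. i < n \<Longrightarrow> j < n \<Longrightarrow> x i \<noteq> y j"
    and dom: "\<And>c. card {z \<in> y ` {..<n}. c < z} \<le> card {z \<in> x ` {..<n}. c < z}"
    and k: "k < n"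
  shows "y k < x k"
proof (rule ccontr)
  assume "\<not> y k < x k"
  with ne[OF k k] have less: "x k < y k" by simp
  have "y ` {k..<n} \<subseteq> {z \<in> y ` {..<n}. x k < z}"
  proof (rule image_subsetI)
    fix i assume i: "i \<in> {k..<n}"
    then have "y k \<le> y i" using strict_mono_onD[OF y, of k i] by (cases "k = i") auto
    with less i show "y i \<in> {z \<in> y ` {..<n}. x k < z}" by simp
  qed
  then have "card (y ` {k..<n}) \<le> card {z \<in> y ` {..<n}. x k < z}" by (intro card_mono) auto
  moreover have "card (y ` {k..<n}) = n - k"
    using strict_mono_on_imp_inj_on[OF y] by (subst card_image) (auto intro: inj_on_subset)
  moreover have "{z \<in> x ` {..<n}. x k < z} \<subseteq> x ` {Suc k..<n}"
  proof
    fix z assume "z \<in> {z \<in> x ` {..<n}. x k < z}"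
    then obtain i where i: "i < n" "x k < x i" "z = x i" by auto
    then have "k < i" using strict_mono_onD[OF x, of i k] k
      by (metis lessThan_iff linorder_neqE_nat order.asym)
    then show "z \<in> x ` {Suc k..<n}" using i by simp
  qed
  then have "card {z \<in> x ` {..<n}. x k < z} \<le> card {Suc k..<n}"
    by (meson card_image_le card_mono finite_atLeastLessThan finite_imageI le_trans)
  ultimately show False using dom[of "x k"] k by simp
qed

text \<open>The entries depend on differences only, so a common shift \<open>s\<close> is free; it
  serves to make sequences nonnegative.\<close>

lemma det_cauchy_mat_eq_0_iff:
  assumes "inj_on b {..<n}"
  shows "det (cauchy_mat n a b) = 0 \<longleftrightarrow>
    singular_on cauchy_entry ((\<lambda>i. a i + s) ` {..<n}) ((\<lambda>i. b i + s) ` {..<n})"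
proof -
  have "inj_on (\<lambda>i. b i + s) {..<n}" using assms by (auto simp: inj_on_def)
  moreover have "cauchy_entry (x + s) (y + s) = (if x > y then 1 / of_int (x - y) else 0)" for x y
    by (cases "x > y") (auto simp: cauchy_entry_def)
  ultimately show ?thesis
    by (subst det_eq_0_iff_singular_on[symmetric]) (auto simp: cauchy_mat_def)
qed

text \<open>Beta numbers decrease for both partitions, whereas in a restricted Cauchy matrix
  \<open>a\<close> decreases and \<open>b\<close> increases; reversal mediates.\<close>

lemma image_reverse_lessThan: "(\<lambda>i. f (n - 1 - i)) ` {..<n} = f ` {..<n :: nat}"
proof -
  have "(\<lambda>i. n - 1 - i) ` {..<n} = {..<n}"
    by (rule endo_inj_surj) (auto simp: inj_on_def)
  then show ?thesis using image_image[of f "\<lambda>i. n - 1 - i" "{..<n}"] by simp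
qed

text \<open>Since \<open>m\<close> lies below \<open>l\<close>, above every threshold
  \<open>A\<close> has at least as many elements as \<open>B\<close>. Discarding the common elements
  preserves this, so the increasing enumerations of \<open>A - B\<close> and \<open>B - A\<close>
  compare termwise.\<close>

lemma restricted_cauchy_of_skew_partition:
  fixes l m N
  defines "A \<equiv> beta_num l ` {..<N}" and "B \<equiv> beta_num m ` {..<N}"
  assumes sk: "skew_partition l m"
  shows "\<exists>M. restricted_cauchy M \<and> (det M = 0 \<longleftrightarrow> singular_on cauchy_entry (A - B) (B - A))"
proof -
  have anti: "antimono l" "antimono m" and ml: "\<And>i. m i \<le> l i"
    using sk by (auto simp: skew_partition_def is_partition_def)
  note inj = inj_on_subset[OF inj_beta_num subset_UNIV]
  have fin: "finite A" "finite B" by (auto simp: A_def B_def)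
  have "card A = N" "card B = N" unfolding A_def B_def using anti by (simp_all add: card_image inj)
  then have card_eq: "card (B - A) = card (A - B)"
    using fin by (simp add: card_Diff_subset_Int Int_commute)
  define n where "n = card (A - B)"
  obtain x where x: "strict_mono_on {..<n} x" "x ` {..<n} = A - B"
    using enumerate_increasing[of "A - B"] fin unfolding n_def by blast
  obtain y where y: "strict_mono_on {..<n} y" "y ` {..<n} = B - A"
    using enumerate_increasing[of "B - A"] fin unfolding n_def card_eq by blast
  have xy: "x i \<noteq> y j" if "i < n" "j < n" for i j
    using x(2) y(2) that by (metis Diff_iff imageI lessThan_iff)
  have dom: "card {z \<in> B - A. c < z} \<le> card {z \<in> A - B. c < z}" for c
  proof -
    have part: "card {z \<in> A' - B'. c < z} + card {z \<in> A' \<inter> B'. c < z} = card {z \<in> A'. c < z}"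
      if "finite A'" for A' B' :: "int set"
      using that by (subst card_Un_disjoint[symmetric]) (auto intro!: arg_cong[where f = card])
    have img: "{z \<in> beta_num l' ` {..<N}. c < z} = beta_num l' ` {i. i < N \<and> c < beta_num l' i}" for l'
      by auto
    have "card {z \<in> B. c < z} = card {i. i < N \<and> c < beta_num m i}"
      unfolding B_def img using anti by (simp add: card_image inj)
    also have "\<dots> \<le> card {i. i < N \<and> c < beta_num l i}"
      using ml by (intro card_mono) (auto simp: beta_num_def intro: less_le_trans)
    also have "\<dots> = card {z \<in> A. c < z}"
      unfolding A_def img using anti by (simp add: card_image inj)
    finally show ?thesis using part[OF fin(1), of B] part[OF fin(2), of A] by (simp add: Int_commute)
  qed
  have less: "y k < x k" if "k < n" for k
    using increasing_enumerations_less[OF x(1) y(1) xy _ that] dom by (simp add: x(2) y(2))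
  \<comment> \<open>Reversal makes \<open>a\<close> decreasing and turns \<open>y k < x k\<close> at
    \<open>k = n - 1 - i\<close> into the required inequality for \<open>a i\<close>.\<close>
  define a where "a i = x (n - 1 - i)" for i
  have a_img: "a ` {..<n} = A - B"
    unfolding a_def[abs_def] image_reverse_lessThan by (rule x(2))
  have "restricted_cauchy (cauchy_mat n a y)"
    unfolding restricted_cauchy_def
  proof (intro exI conjI allI impI)
    show "a j < a i" if "i < n" "j < n" "i < j" for i j
      unfolding a_def using that by (intro strict_mono_onD[OF x(1)]) auto
    show "y i < y j" if "i < n" "j < n" "i < j" for i j
      using that by (intro strict_mono_onD[OF y(1)]) auto
    show "y (n - 1 - i) < a i" if "i < n" for i unfolding a_def using that by (intro less) simp
    show "a i \<noteq> y j" if "i < n" "j < n" for i j unfolding a_def using that by (intro xy) auto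
  qed simp
  moreover have "det (cauchy_mat n a y) = 0 \<longleftrightarrow> singular_on cauchy_entry (A - B) (B - A)"
    using det_cauchy_mat_eq_0_iff[OF strict_mono_on_imp_inj_on[OF y(1)], of a 0]
    by (simp add: a_img y(2))
  ultimately show ?thesis by blast
qed

text \<open>Shifted and put in decreasing order, \<open>a\<close> and \<open>b\<close> become the
  first \<open>n\<close> beta numbers of \<open>l\<close> and \<open>m\<close>. The inequality
  between \<open>a\<close> and the reversed \<open>b\<close> is containment of the shapes, and since
  no \<open>a i\<close> equals a \<open>b j\<close>, nothing is lost in the set differences.\<close>

lemma skew_partition_of_restricted_cauchy:
  assumes "restricted_cauchy M"
  shows "\<exists>l m N. skew_partition l m \<and> (\<forall>i\<ge>N. l i = 0) \<and> (det M = 0 \<longleftrightarrow>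
    singular_on cauchy_entry (beta_num l ` {..<N} - beta_num m ` {..<N})
      (beta_num m ` {..<N} - beta_num l ` {..<N}))"
proof -
  obtain n a b where a: "\<And>i j. i < n \<Longrightarrow> j < n \<Longrightarrow> i < j \<Longrightarrow> a j < a i"
    and b: "\<And>i j. i < n \<Longrightarrow> j < n \<Longrightarrow> i < j \<Longrightarrow> b i < b j"
    and ab: "\<And>i. i < n \<Longrightarrow> b (n - 1 - i) < a i"
    and ne: "\<And>i j. i < n \<Longrightarrow> j < n \<Longrightarrow> a i \<noteq> b j"
    and M: "M = cauchy_mat n a b"
    using assms unfolding restricted_cauchy_def by blast
  \<comment> \<open>The least value of \<open>b\<close> is \<open>b 0\<close>, so this shift makes
    all of \<open>b\<close> nonnegative, and with it the larger values of \<open>a\<close>.\<close>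
  define s where "s = \<bar>b 0\<bar>"
  have b0: "b 0 \<le> b i" if "i < n" for i using b[of 0 i] that by (cases "i = 0") auto
  have bs: "0 \<le> b (n - 1 - i) + s" if "i < n" for i
    using b0[of "n - 1 - i"] that by (simp add: s_def)
  have as: "0 \<le> a i + s" if "i < n" for i using ab[OF that] bs[OF that] by simp
  define l where "l i = (if i < n then nat (a i + s + int i) else 0)" for i
  define m where "m i = (if i < n then nat (b (n - 1 - i) + s + int i) else 0)" for i
  have l: "is_partition l" "\<And>i. i < n \<Longrightarrow> beta_num l i = a i + s"
    using strictly_decreasing_partition[of n "\<lambda>i. a i + s"] a as
    unfolding l_def[abs_def] by auto
  have m: "is_partition m" "\<And>i. i < n \<Longrightarrow> beta_num m i = b (n - 1 - i) + s"
    using strictly_decreasing_partition[of n "\<lambda>i. b (n - 1 - i) + s"] b bs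
    unfolding m_def[abs_def] by auto
  have "m i \<le> l i" for i using ab[of i] by (auto simp: l_def m_def)
  then have sk: "skew_partition l m" using l m by (simp add: skew_partition_def)
  have A: "beta_num l ` {..<n} = (\<lambda>i. a i + s) ` {..<n}" using l(2) by (intro image_cong) auto
  have "beta_num m ` {..<n} = (\<lambda>i. b (n - 1 - i) + s) ` {..<n}" using m(2) by (intro image_cong) auto
  also have "\<dots> = (\<lambda>i. b i + s) ` {..<n}" by (rule image_reverse_lessThan)
  finally have B: "beta_num m ` {..<n} = (\<lambda>i. b i + s) ` {..<n}" .
  have disj: "(\<lambda>i. a i + s) ` {..<n} \<inter> (\<lambda>i. b i + s) ` {..<n} = {}" using ne by auto
  have "inj_on b {..<n}" by (rule linorder_inj_onI) (use b in force)+
  from det_cauchy_mat_eq_0_iff[OF this, of a s] sk disj show ?thesis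
    by (intro exI[of _ l] exI[of _ m] exI[of _ n]) (simp add: A B M l_def Diff_triv Int_commute)
qed

theorem theorem5p2:
  "(\<forall>l m. skew_partition l m \<longrightarrow> skew_rank l m = zrank l m) \<longleftrightarrow>
   (\<forall>A. restricted_cauchy A \<longrightarrow> nonsingular A)"
proof
  assume rank: "\<forall>l m. skew_partition l m \<longrightarrow> skew_rank l m = zrank l m"
  show "\<forall>A. restricted_cauchy A \<longrightarrow> nonsingular A"
  proof (intro allI impI)
    fix M assume "restricted_cauchy M"
    from skew_partition_of_restricted_cauchy[OF this] rank show "nonsingular M"
      using skew_rank_eq_zrank_iff by (metis nonsingular_def)
  qed
next
  assume nonsing: "\<forall>A. restricted_cauchy A \<longrightarrow> nonsingular A"
  show "\<forall>l m. skew_partition l m \<longrightarrow> skew_rank l m = zrank l m"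
  proof (intro allI impI)
    fix l m assume sk: "skew_partition l m"
    then have "finite {i. l i \<noteq> 0}" by (simp add: skew_partition_def is_partition_def)
    then obtain N where "\<forall>i\<in>{i. l i \<noteq> 0}. i < N" using finite_nat_set_iff_bounded by blast
    then have N: "\<forall>i\<ge>N. l i = 0" by (metis mem_Collect_eq not_less)
    show "skew_rank l m = zrank l m"
      using restricted_cauchy_of_skew_partition[OF sk, of N] skew_rank_eq_zrank_iff[OF sk N] nonsing
      by (auto simp: nonsingular_def)
  qed
qed

end
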